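(* Let $h:\mathbb{Z}[1,T]\to\mathbb{R}^N$. Assume that $j(x,x)=0$ for all $x\in\mathbb{R}^N$ and that the restriction $j|_{D(j)}$ is bounded. If there are constants $\alpha,c\ge0$ such that $$|\nabla_vF(n,v)|\le c(|v|^\alpha+1)\qquad(n\in\mathbb{Z}[1,T],\ v\in\mathbb{R}^N)$$ and $$\lim_{|v|\to\infty}|v|^{-\alpha}\left[\overline{F}(v)+\langle\overline{h}|v\rangle\right]=+\infty,$$ then the problem $$\begin{cases}-\Delta[\phi(\Delta u(n-1))]=\nabla_u F(n,u(n))+h(n) & (n\in\mathbb{Z}[1,T]),\\ (\phi(\Delta u(0)),-\phi(\Delta u(T)))\in\partial j(u(0),u(T+1))\end{cases}$$ has at least one solution.
   Context: $N\ge 1$ and $T\ge 2$ are fixed integers and $a>0$ is fixed. $\langle\cdot|\cdot\rangle$ and $|\cdot|$ are the Euclidean inner product and norm on $\mathbb{R}^N$, and $\mathbb{R}^N\times\mathbb{R}^N$ carries its usual inner product. $B_a=\{x\in\mathbb{R}^N:|x|<a\}$. $\mathbb{Z}[p,q]=\{p,\dots,q\}$. $\overline{h}=\frac1T\sum_{k=1}^Th(k)$ and $\overline{F}(v)=\frac1T\sum_{n=1}^TF(n,v)$ for $v\in\mathbb{R}^N$. For $u:\mathbb{Z}[0,T+1]\to\mathbb{R}^N$: $\Delta u(n-1)=u(n)-u(n-1)$, $\Delta[\phi(\Delta u(n-1))]=\phi(\Delta u(n))-\phi(\Delta u(n-1))$, $\|\Delta u\|_\infty=\max_{n\in\mathbb{Z}[1,T+1]}|\Delta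 u(n-1)|$. The convention $0^0=0$ is used when $\alpha=0$. Assumptions. (1) $\phi: B_a\to\mathbb{R}^N$ is a homeomorphism from $B_a$ onto $\mathbb{R}^N$ with $\phi(0)=0$ and $\phi=\nabla\Phi$ on $B_a$, where $\Phi:\overline{B}_a\to\mathbb{R}$ is of class $C^1$ on $B_a$, continuous and strictly convex on $\overline{B}_a$, $\Phi(0)=0$. (2) $F=F(n,u):\mathbb{Z}[1,T]\times\mathbb{R}^N\to\mathbb{R}$ is continuous, $\nabla_uF$ exists and is continuous on $\mathbb{Z}[1,T]\times\mathbb{R}^N$, and $F(\cdot,0)=0$. (3) $j:\mathbb{R}^N\times\mathbb{R}^N\to(-\infty,+\infty]$ is proper, convex, lower semicontinuous, $j(0,0)=0$ and $(0,0)\in\partial j(0,0)$, where $\partial j$ is the subdifferential in the sense of convex analysis; $D(j)=\{z:j(z)<+\infty\}$. A solution of the problem is a function $u:\mathbb{Z}[0,T+1]\to\mathbb{R}^N$ with $\|\Delta u\|_\infty<a$ and $\partial j(u(0),u(T+1))\neq\emptyset$ that satisfies both the equations and the boundary condition. *)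

theory Defs
  imports "HOL-Analysis.Analysis"
begin

definition strictly_convex_on :: "'a::real_vector set \<Rightarrow> ('a \<Rightarrow> real) \<Rightarrow> bool" where
  "strictly_convex_on S f \<longleftrightarrow> convex S \<and>
    (\<forall>x\<in>S. \<forall>y\<in>S. \<forall>t. x \<noteq> y \<and> 0 < t \<and> t < 1 \<longrightarrow>
       f ((1 - t) *\<^sub>R x + t *\<^sub>R y) < (1 - t) * f x + t * f y)"

definition eff_domain :: "('a \<Rightarrow> ereal) \<Rightarrow> 'a set" where
  "eff_domain j = {z. j z < \<infinity>}"

definition proper_fun :: "('a \<Rightarrow> ereal) \<Rightarrow> bool" where
  "proper_fun j \<longleftrightarrow> (\<forall>z. j z \<noteq> - \<infinity>) \<and> eff_domain j \<noteq> {}"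

(* Meant for functions that omit the value minus infinity, so that the sum on the
   right-hand side is never of the form infinity minus infinity. *)
definition convex_ereal :: "('a::real_vector \<Rightarrow> ereal) \<Rightarrow> bool" where
  "convex_ereal j \<longleftrightarrow>
    (\<forall>x y t. 0 < t \<and> t < 1 \<longrightarrow>
       j ((1 - t) *\<^sub>R x + t *\<^sub>R y) \<le> ereal (1 - t) * j x + ereal t * j y)"

definition lower_semicontinuous :: "('a::topological_space \<Rightarrow> ereal) \<Rightarrow> bool" where
  "lower_semicontinuous j \<longleftrightarrow> (\<forall>z. j z \<le> Liminf (at z) j)"

(* For proper j this set is empty outside the effective domain: at a point with
   j z = infinity the inequality fails for every w in the domain. *)
definition subdifferential :: "('a::real_inner \<Rightarrow> ereal) \<Rightarrow> 'a \<Rightarrow> 'a set" where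
  "subdifferential j z = {\<xi>. \<forall>w. j z + ereal (\<xi> \<bullet> (w - z)) \<le> j w}"

definition fdiff :: "(nat \<Rightarrow> 'a::ab_group_add) \<Rightarrow> nat \<Rightarrow> 'a" where
  "fdiff u n = u (Suc n) - u n"

definition fdiff_norm :: "nat \<Rightarrow> (nat \<Rightarrow> 'a::real_normed_vector) \<Rightarrow> real" where
  "fdiff_norm T u = Max ((\<lambda>n. norm (fdiff u (n - 1))) ` {1..T + 1})"

definition avg :: "nat \<Rightarrow> (nat \<Rightarrow> 'a::real_vector) \<Rightarrow> 'a" where
  "avg T h = (1 / real T) *\<^sub>R (\<Sum>n = 1..T. h n)"

(* Functions on {0..T+1} or {1..T} are represented by functions on nat of which only
   the values on these index sets are used. The argument gF stands for the
   gradient of F in its second variable. *)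
definition is_solution ::
  "nat \<Rightarrow> real \<Rightarrow> ('a::euclidean_space \<Rightarrow> 'a) \<Rightarrow> (nat \<Rightarrow> 'a \<Rightarrow> 'a) \<Rightarrow> (nat \<Rightarrow> 'a) \<Rightarrow>
   ('a \<times> 'a \<Rightarrow> ereal) \<Rightarrow> (nat \<Rightarrow> 'a) \<Rightarrow> bool" where
  "is_solution T a \<phi> gF h j u \<longleftrightarrow>
     fdiff_norm T u < a \<and>
     subdifferential j (u 0, u (T + 1)) \<noteq> {} \<and>
     (\<forall>n\<in>{1..T}. - fdiff (\<lambda>m. \<phi> (fdiff u m)) (n - 1) = gF n (u n) + h n) \<and>
     (\<phi> (fdiff u 0), - \<phi> (fdiff u T)) \<in> subdifferential j (u 0, u (T + 1))"

end

theory Submission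
  imports Defs
begin

text \<open>
  Since \<open>j\<close> is convex, lower semicontinuous and zero on the diagonal, every diagonal vector is a
  direction of recession, so \<open>j (x, y) = j (0, y - x)\<close> (\<open>diagonal_translation_invariance\<close>). Write a path
  as \<open>u n = x + y n\<close> with \<open>y 0 = 0\<close>, and put \<open>G n v = F n v + h n \<bullet> v\<close>. Solutions are critical points of
  the action
    \<open>(\<Sum>n\<le>T. \<Phi> (\<Delta>y n)) + j (0, y (T + 1)) - (\<Sum>n=1..T. G n (x + y n))\<close>.
  The constraint \<open>|\<Delta>y n| \<le> a\<close> and the closedness of the domain of \<open>j\<close> (this is where the boundedness of
  \<open>j\<close> enters) confine \<open>y\<close> to a compact convex set, while the growth bound and the coercivity assumption
  make the action tend to minus infinity as \<open>|x|\<close> tends to infinity, uniformly in \<open>y\<close>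
  (\<open>perturbed_sum_coercive\<close>). This is a saddle point geometry.

  To produce a critical point, let \<open>w n\<close> be the gradient of \<open>G n\<close> at \<open>u n\<close> and let the reply to \<open>(x, y)\<close>
  be the unique minimizer of the convex part of the action minus \<open>\<Sum>n. w n \<bullet> y n\<close>; it depends
  continuously on \<open>(x, y)\<close>. A point is critical iff it is its own reply and \<open>\<Sum>n. w n = 0\<close>. If there is
  no critical point, then moving \<open>y\<close> a little towards its reply and \<open>x\<close> a little along \<open>\<Sum>n. w n\<close> is a
  continuous map that lowers the action by a fixed amount where \<open>|x|\<close> is bounded
  (\<open>action_move_le\<close>); a cutoff makes it the identity for large \<open>|x|\<close>. Iterating it on the set of points
  \<open>(x, 0)\<close> with \<open>|x| \<le> R\<close> drives the action on the whole image below its minimum over \<open>x = 0\<close>. But by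
  Brouwer's theorem (\<open>continuous_map_fixing_sphere_has_zero\<close>) the image still meets \<open>x = 0\<close>. This
  contradiction is \<open>critical_point_exists\<close>; no flow or deformation lemma is needed.

  Finally, a minimizer of the tilted convex problem has \<open>|\<Delta>y n| < a\<close> because the radial derivative of
  \<open>\<Phi>\<close> is infinite on the sphere of radius \<open>a\<close> (\<open>phi_inner_unbounded\<close>, \<open>minimizer_interior\<close>), so its
  Euler-Lagrange conditions hold: they are the difference equations
  (\<open>minimizer_difference_equation\<close>) and the boundary inclusion (\<open>minimizer_boundary_inequality\<close>). The
  condition \<open>\<Sum>n. w n = 0\<close> gives \<open>\<phi> (\<Delta>u 0) = \<phi> (\<Delta>u T)\<close>.
\<close>

section \<open>Gradients, zeros of maps of the ball, and continuity of minimizers\<close>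

lemma GDERIV_along_line:
  assumes "GDERIV f (p + t *\<^sub>R v) :> g"
  shows "((\<lambda>s. f (p + s *\<^sub>R v)) has_real_derivative (g \<bullet> v)) (at t)"
proof -
  have "(f has_derivative (\<lambda>h. h \<bullet> g)) (at (p + t *\<^sub>R v))"
    using assms by (simp add: gderiv_def)
  moreover have "((\<lambda>s. p + s *\<^sub>R v) has_derivative (\<lambda>s. s *\<^sub>R v)) (at t)"
    by (auto intro!: derivative_eq_intros)
  ultimately have "((\<lambda>s. f (p + s *\<^sub>R v)) has_derivative (\<lambda>s. (s *\<^sub>R v) \<bullet> g)) (at t)"
    by (rule has_derivative_compose[rotated])
  then show ?thesis
    by (simp add: has_field_derivative_def inner_commute mult.commute[of "g \<bullet> v"] cong: if_cong)
       (simp add: mult_commute_abs)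
qed

lemma GDERIV_mean_value:
  fixes f :: "'a::real_inner \<Rightarrow> real"
  assumes "\<And>z. GDERIV f z :> g z"
  shows "\<exists>t\<in>{0..1}. f (p + v) = f p + g (p + t *\<^sub>R v) \<bullet> v"
proof -
  obtain t where t: "0 < t" "t < 1"
    "f (p + 1 *\<^sub>R v) - f (p + 0 *\<^sub>R v) = (1 - 0) * (g (p + t *\<^sub>R v) \<bullet> v)"
    using MVT2[of 0 1 "\<lambda>t. f (p + t *\<^sub>R v)" "\<lambda>t. g (p + t *\<^sub>R v) \<bullet> v"]
    by (auto intro: GDERIV_along_line assms)
  then show ?thesis by (intro bexI[of _ t]) (simp_all add: algebra_simps)
qed

lemma GDERIV_uniform_lower_bound:
  fixes f :: "'a::euclidean_space \<Rightarrow> real"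
  assumes "\<And>z. GDERIV f z :> g z" "continuous_on UNIV g" "\<epsilon> > 0"
  shows "\<exists>\<delta>>0. \<forall>p\<in>cball 0 R. \<forall>v. norm v \<le> \<delta> \<longrightarrow> f p + g p \<bullet> v - \<epsilon> * norm v \<le> f (p + v)"
proof -
  have "uniformly_continuous_on (cball 0 (R + 1)) g"
    using assms(2) by (intro compact_uniformly_continuous) (auto intro: continuous_on_subset)
  then obtain d where d: "d > 0"
    "\<And>x y. x \<in> cball 0 (R+1) \<Longrightarrow> y \<in> cball 0 (R+1) \<Longrightarrow> dist y x < d \<Longrightarrow> dist (g y) (g x) < \<epsilon>"
    using \<open>\<epsilon> > 0\<close> unfolding uniformly_continuous_on_def by metis
  have "f p + g p \<bullet> v - \<epsilon> * norm v \<le> f (p + v)"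
    if "p \<in> cball 0 R" "norm v \<le> min 1 (d/2)" for p v
  proof -
    obtain t where t: "t \<in> {0..1}" "f (p + v) = f p + g (p + t *\<^sub>R v) \<bullet> v"
      using GDERIV_mean_value[OF assms(1)] by blast
    have tv: "norm (t *\<^sub>R v) \<le> norm v"
      using t(1) by (simp add: mult_left_le_one_le)
    have "dist (g (p + t *\<^sub>R v)) (g p) < \<epsilon>"
    proof (rule d(2))
      show "p + t *\<^sub>R v \<in> cball 0 (R + 1)"
        using norm_triangle_ineq[of p "t *\<^sub>R v"] that tv by simp
      show "dist (p + t *\<^sub>R v) p < d" using tv that d(1) by (simp add: dist_norm)
    qed (use that in auto)
    then have "norm (g p - g (p + t *\<^sub>R v)) \<le> \<epsilon>" by (simp add: dist_norm norm_minus_commute)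
    then have "(g p - g (p + t *\<^sub>R v)) \<bullet> v \<le> \<epsilon> * norm v"
      by (meson mult_right_mono norm_cauchy_schwarz norm_ge_zero order_trans)
    then show ?thesis using t(2) by (simp add: inner_diff_left)
  qed
  then show ?thesis using d(1) by (intro exI[of _ "min 1 (d/2)"]) auto
qed

lemma convex_gradient_inequality:
  fixes \<Phi> :: "'a::real_inner \<Rightarrow> real"
  assumes conv: "\<And>t. 0 < t \<Longrightarrow> t < 1 \<Longrightarrow> \<Phi> ((1 - t) *\<^sub>R z + t *\<^sub>R y) \<le> (1 - t) * \<Phi> z + t * \<Phi> y"
    and "GDERIV \<Phi> z :> g"
  shows "\<Phi> z + g \<bullet> (y - z) \<le> \<Phi> y"
proof (rule ccontr)
  assume neg: "\<not> ?thesis"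
  let ?H = "\<lambda>t. \<Phi> z + t * (\<Phi> y - \<Phi> z) - \<Phi> (z + t *\<^sub>R (y - z))"
  have dH: "(?H has_real_derivative (\<Phi> y - \<Phi> z) - g \<bullet> (y - z)) (at 0)"
    using GDERIV_along_line[of \<Phi> z 0 "y - z" g] assms(2)
    by (auto intro!: derivative_eq_intros)
  have "(\<Phi> y - \<Phi> z) - g \<bullet> (y - z) < 0" using neg by simp
  from DERIV_neg_dec_right[OF dH this]
  obtain d where d: "d > 0" "\<And>t. 0 < t \<Longrightarrow> t < d \<Longrightarrow> ?H (0 + t) < ?H 0"
    by blast
  define t where "t = min (1/2) (d/2)"
  have t: "0 < t" "t < d" "t < 1" using d(1) by (auto simp: t_def)
  have "z + t *\<^sub>R (y - z) = (1 - t) *\<^sub>R z + t *\<^sub>R y" by (simp add: algebra_simps)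
  then have "\<Phi> (z + t *\<^sub>R (y - z)) \<le> \<Phi> z + t * (\<Phi> y - \<Phi> z)"
    using conv[OF t(1,3)] by (simp add: algebra_simps)
  then show False using d(2)[OF t(1,2)] by simp
qed

text \<open>A form of the no-retraction theorem.\<close>

lemma continuous_map_fixing_sphere_has_zero:
  fixes \<gamma> :: "'a::euclidean_space \<Rightarrow> 'a"
  assumes "R > 0" "continuous_on (cball 0 R) \<gamma>" "\<And>x. norm x = R \<Longrightarrow> \<gamma> x = x"
  shows "\<exists>x\<in>cball 0 R. \<gamma> x = 0"
proof (rule ccontr)
  assume nz: "\<not> ?thesis"
  \<comment> \<open>A fixed point of \<open>f\<close> would lie on the sphere, where \<open>f\<close> is the antipodal map.\<close>
  define f where "f x = - ((R / norm (\<gamma> x)) *\<^sub>R \<gamma> x)" for x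
  have nf: "norm (f x) = R" if "x \<in> cball 0 R" for x
    using nz that \<open>R > 0\<close> by (auto simp: f_def)
  have "continuous_on (cball 0 R) f"
    unfolding f_def using nz by (intro continuous_intros assms) auto
  then obtain x where x: "x \<in> cball 0 R" "f x = x"
    using brouwer_ball[of R 0 f] nf \<open>R > 0\<close> by (metis Pi_I mem_cball_0 order_refl)
  then have "norm x = R" using nf by force
  then have "f x = - x" using assms(1,3) by (simp add: f_def)
  then show False using x \<open>norm x = R\<close> \<open>R > 0\<close>
    by (metis norm_zero less_irrefl scaleR_2 eq_neg_iff_add_eq_0 scaleR_eq_0_iff zero_neq_numeral)
qed

lemma continuous_on_unique_minimizer:
  fixes Q :: "'w::metric_space \<Rightarrow> 'k::metric_space \<Rightarrow> real"
  assumes "compact K"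
    and Q: "continuous_on (W \<times> K) (\<lambda>(w, k). Q w k)"
    and A: "\<And>w. w \<in> W \<Longrightarrow> A w \<in> K"
    and min: "\<And>w k. w \<in> W \<Longrightarrow> k \<in> K \<Longrightarrow> Q w (A w) \<le> Q w k"
    and uniq: "\<And>w k. w \<in> W \<Longrightarrow> k \<in> K \<Longrightarrow> (\<And>k'. k' \<in> K \<Longrightarrow> Q w k \<le> Q w k') \<Longrightarrow> k = A w"
  shows "continuous_on W A"
proof (rule continuous_on_sequentiallyI)
  show "(\<lambda>n. A (u n)) \<longlonglongrightarrow> A w"
    if uW': "\<forall>n. u n \<in> W" and w: "w \<in> W" and u: "u \<longlonglongrightarrow> w" for u w
  proof (rule ccontr)
    have uW: "u n \<in> W" for n using uW' by simp
    assume "\<not> ?thesis"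
    then obtain e where e: "e > 0" "\<exists>\<^sub>F n in sequentially. e \<le> dist (A (u n)) (A w)"
      by (auto simp: tendsto_iff not_eventually not_less)
    then have "infinite {n. e \<le> dist (A (u n)) (A w)}"
      by (simp add: frequently_cofinite[symmetric] cofinite_eq_sequentially)
    then obtain s :: "nat \<Rightarrow> nat" where "strict_mono s" "\<forall>n. s n \<in> {n. e \<le> dist (A (u n)) (A w)}"
      using infinite_enumerate by blast
    then have s: "strict_mono s" "e \<le> dist (A (u (s n))) (A w)" for n by auto
    have "\<forall>n. A (u (s n)) \<in> K" using A uW by simp
    then obtain k q where "k \<in> K" "strict_mono q" "((\<lambda>n. A (u (s n))) \<circ> q) \<longlonglongrightarrow> k"
      by (rule seq_compactE[OF compact_imp_seq_compact[OF assms(1)]])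
    then have kq: "k \<in> K" "strict_mono q" "(\<lambda>n. A (u (s (q n)))) \<longlonglongrightarrow> k"
      by (simp_all add: o_def)
    have us: "(\<lambda>n. u (s (q n))) \<longlonglongrightarrow> w"
      using LIMSEQ_subseq_LIMSEQ[OF LIMSEQ_subseq_LIMSEQ[OF u s(1)] kq(2)] by (simp add: o_def)
    have lim: "(\<lambda>n. Q (u (s (q n))) (x n)) \<longlonglongrightarrow> Q w x'"
      if "x \<longlonglongrightarrow> x'" "\<And>n. x n \<in> K" "x' \<in> K" for x x'
      using continuous_on_tendsto_compose[OF Q tendsto_Pair[OF us that(1)]] w uW that by simp
    have "Q w k \<le> Q w k'" if "k' \<in> K" for k'
      by (rule LIMSEQ_le[OF lim[OF kq(3)] lim[OF tendsto_const[of k']]])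
         (use kq(1) A uW that min in simp_all)
    then have "k = A w" using uniq[OF w kq(1)] by simp
    then have "(\<lambda>n. dist (A (u (s (q n)))) (A w)) \<longlonglongrightarrow> 0"
      using kq(3) by (intro tendsto_dist_iff[THEN iffD1]) simp
    then have "e \<le> 0"
      by (rule LIMSEQ_le_const) (intro exI[of _ 0] allI impI s(2))
    then show False using e by simp
  qed
qed

section \<open>The convex part of the action\<close>

lemma continuous_on_fst_coordinate [continuous_intros]:
  fixes p :: "'x::topological_space \<Rightarrow> ('i \<Rightarrow> 'a::topological_space) \<times> 'b::topological_space"
  assumes "continuous_on X p"
  shows "continuous_on X (\<lambda>x. fst (p x) n)"
  by (rule continuous_on_product_then_coordinatewise[OF continuous_on_fst[OF assms]])

lemma continuous_on_fdiff_fst [continuous_intros]: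
  fixes p :: "'x::topological_space \<Rightarrow> (nat \<Rightarrow> 'a::real_normed_vector) \<times> 'b::topological_space"
  assumes "continuous_on X p"
  shows "continuous_on X (\<lambda>x. fdiff (fst (p x)) n)"
  unfolding fdiff_def by (intro continuous_on_diff continuous_on_fst_coordinate assms)

text \<open>
  The convex combination of two pairs (path, number). It is spelled out because function types
  carry no vector space structure; their product topology is used throughout.
\<close>

definition mix :: "real \<Rightarrow> (nat \<Rightarrow> 'v::real_vector) \<times> real \<Rightarrow> (nat \<Rightarrow> 'v) \<times> real \<Rightarrow> (nat \<Rightarrow> 'v) \<times> real" where
  "mix t k l = (\<lambda>n. (1 - t) *\<^sub>R fst k n + t *\<^sub>R fst l n, (1 - t) * snd k + t * snd l)"

lemma fst_mix: "fst (mix t k l) n = (1 - t) *\<^sub>R fst k n + t *\<^sub>R fst l n"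
  and snd_mix: "snd (mix t k l) = (1 - t) * snd k + t * snd l"
  by (simp_all add: mix_def)

lemma fdiff_mix: "fdiff (fst (mix t k l)) n = (1 - t) *\<^sub>R fdiff (fst k) n + t *\<^sub>R fdiff (fst l) n"
  by (simp add: fdiff_def fst_mix algebra_simps)

lemma continuous_on_mix [continuous_intros]:
  fixes p q :: "'x::topological_space \<Rightarrow> (nat \<Rightarrow> 'v::real_normed_vector) \<times> real"
  assumes "continuous_on X s" "continuous_on X p" "continuous_on X q"
  shows "continuous_on X (\<lambda>x. mix (s x) (p x) (q x))"
  unfolding mix_def
  by (intro continuous_on_Pair continuous_on_coordinatewise_then_product continuous_on_add continuous_on_scaleR
      continuous_on_mult continuous_on_diff continuous_on_const continuous_on_fst_coordinate continuous_on_snd assms)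

text \<open>
  The set \<open>S\<close> stands for the part below height \<open>M\<close> of the epigraph of \<open>v \<mapsto> j (0, v)\<close>. Treating the height as an
  additional variable turns a lower semicontinuous problem into a continuous one: the state is a pair
  of a path and a height, and the height is added to the energy. The assumption \<open>phi_blowup\<close> says that
  \<open>|\<phi> z|\<close> tends to infinity as \<open>|z|\<close> tends to \<open>a\<close>.
\<close>

locale singular_energy =
  fixes T :: nat and a M :: real
    and \<phi> :: "'v::euclidean_space \<Rightarrow> 'v" and \<Phi> :: "'v \<Rightarrow> real" and S :: "('v \<times> real) set"
  assumes a_pos: "a > 0"
    and phi_0: "\<phi> 0 = 0"
    and phi_grad: "\<And>x. x \<in> ball 0 a \<Longrightarrow> GDERIV \<Phi> x :> \<phi> x"
    and phi_blowup: "\<And>B. \<exists>\<rho><a. \<forall>z\<in>ball 0 a. norm (\<phi> z) \<le> B \<longrightarrow> norm z \<le> \<rho>"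
    and Phi_cont: "continuous_on (cball 0 a) \<Phi>"
    and Phi_convex: "strictly_convex_on (cball 0 a) \<Phi>"
    and S_closed: "closed S" and S_convex: "convex S" and S_0: "(0, 0) \<in> S"
    and S_bounds: "\<And>v r. (v, r) \<in> S \<Longrightarrow> 0 \<le> r \<and> r \<le> M"
begin

text \<open>
  Paths starting at the origin with increments of norm at most \<open>a\<close>, together with a height that \<open>S\<close> allows over
  the end point. Setting the values beyond \<open>T + 1\<close>, which play no role, to zero makes the set compact and
  minimizers unique.
\<close>

definition admissible :: "((nat \<Rightarrow> 'v) \<times> real) set" where
  "admissible = {k. fst k 0 = 0 \<and> (\<forall>n\<le>T. norm (fdiff (fst k) n) \<le> a) \<and>
     (\<forall>n>T + 1. fst k n = 0) \<and> (fst k (T + 1), snd k) \<in> S}"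

text \<open>The part of the action given by \<open>\<Phi>\<close> and \<open>j\<close>, with the height in place of the value of \<open>j\<close>.\<close>

definition convex_energy :: "(nat \<Rightarrow> 'v) \<times> real \<Rightarrow> real" where
  "convex_energy k = (\<Sum>n\<le>T. \<Phi> (fdiff (fst k) n)) + snd k"

text \<open>The convex energy minus a linear functional of the path, given by forces \<open>w n\<close>.\<close>

definition tilted_energy :: "(nat \<Rightarrow> 'v) \<Rightarrow> (nat \<Rightarrow> 'v) \<times> real \<Rightarrow> real" where
  "tilted_energy w k = convex_energy k - (\<Sum>n=1..T. w n \<bullet> fst k n)"

lemma Phi_convex_le:
  assumes "x \<in> cball 0 a" "y \<in> cball 0 a" "0 \<le> t" "t \<le> 1"
  shows "\<Phi> ((1 - t) *\<^sub>R x + t *\<^sub>R y) \<le> (1 - t) * \<Phi> x + t * \<Phi> y"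
proof (cases "x = y \<or> t = 0 \<or> t = 1")
  case True
  then show ?thesis by (auto simp flip: scaleR_add_left distrib_right)
next
  case False
  then show ?thesis
    using assms Phi_convex unfolding strictly_convex_on_def by (intro less_imp_le) auto
qed

lemma Phi_gradient_le:
  assumes "z \<in> ball 0 a" "y \<in> cball 0 a"
  shows "\<Phi> z + \<phi> z \<bullet> (y - z) \<le> \<Phi> y"
  using assms by (intro convex_gradient_inequality Phi_convex_le phi_grad) auto

lemma phi_inner_nonneg:
  assumes "z \<in> ball 0 a"
  shows "0 \<le> \<phi> z \<bullet> z"
  using Phi_gradient_le[of z 0] Phi_gradient_le[of 0 z] assms a_pos phi_0 by (simp add: inner_diff_right)

text \<open>
  The radial derivative of \<open>\<Phi>\<close> is infinite on the sphere: the gradient inequality from \<open>z\<close> to the point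
  of norm \<open>a / 2\<close> in the direction of \<open>\<phi> z\<close> gives \<open>\<phi> z \<bullet> z \<ge> (a / 2) |\<phi> z| - const\<close>.
\<close>

lemma phi_inner_unbounded:
  assumes "norm y = a"
  shows "\<exists>t. 0 < t \<and> t < 1 \<and> B < \<phi> ((1 - t) *\<^sub>R y) \<bullet> y"
proof -
  have "bounded (\<Phi> ` cball 0 a)"
    by (intro compact_imp_bounded compact_continuous_image Phi_cont compact_cball)
  then obtain b where b: "\<And>x. x \<in> cball 0 a \<Longrightarrow> \<bar>\<Phi> x\<bar> \<le> b"
    unfolding bounded_iff by (metis imageI real_norm_def)
  define C where "C = 2 * (\<bar>B\<bar> + 2 * b + 1) / a"
  obtain \<rho> where \<rho>: "\<rho> < a" "\<And>z. z \<in> ball 0 a \<Longrightarrow> norm (\<phi> z) \<le> C \<Longrightarrow> norm z \<le> \<rho>"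
    using phi_blowup[of C] by blast
  have b0: "0 \<le> b" using b[of 0] a_pos by auto
  then have C0: "C > 0" using a_pos by (simp add: C_def)
  define t where "t = min (1/2) ((1 - \<rho>/a) / 2)"
  have t: "0 < t" "t < 1" "t * a < a - \<rho>"
    using \<rho>(1) a_pos by (auto simp: t_def min_def field_simps)
  define z where "z = (1 - t) *\<^sub>R y"
  have nz: "norm z = (1 - t) * a" using t assms by (simp add: z_def)
  have zb: "z \<in> ball 0 a" using nz mult_pos_pos[OF t(1) a_pos] by (simp add: algebra_simps)
  have "\<rho> < norm z" using nz t(3) by (simp add: algebra_simps)
  then have big: "C < norm (\<phi> z)" using \<rho>(2)[OF zb] by linarith
  define v where "v = (a / 2 / norm (\<phi> z)) *\<^sub>R \<phi> z"
  have nv: "norm v \<le> a" using big C0 a_pos by (simp add: v_def)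
  have "\<phi> z \<bullet> v = a / 2 * norm (\<phi> z)"
    using big C0 by (simp add: v_def power2_norm_eq_inner[symmetric] power2_eq_square)
  moreover have "\<Phi> z + \<phi> z \<bullet> (v - z) \<le> \<Phi> v" using Phi_gradient_le[OF zb] nv by simp
  ultimately have "a / 2 * norm (\<phi> z) - 2 * b \<le> \<phi> z \<bullet> z"
    using b[of v] b[of z] nv zb by (simp add: inner_diff_right)
  moreover have "\<bar>B\<bar> + 2 * b + 1 < a / 2 * norm (\<phi> z)"
    using big a_pos by (simp add: C_def field_simps)
  moreover have "\<phi> z \<bullet> z \<le> \<phi> z \<bullet> y"
    using phi_inner_nonneg[OF zb] t unfolding z_def
    by (simp add: mult_left_le_one_le zero_le_mult_iff)
  ultimately have "B < \<phi> z \<bullet> y" by linarith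
  then show ?thesis using t by (auto simp: z_def)
qed

lemma zero_admissible: "(\<lambda>n. 0, 0) \<in> admissible"
  using S_0 a_pos by (simp add: admissible_def fdiff_def)

lemma mix_admissible:
  assumes "k \<in> admissible" "l \<in> admissible" "0 \<le> t" "t \<le> 1"
  shows "mix t k l \<in> admissible"
proof -
  have "norm (fdiff (fst (mix t k l)) n) \<le> a" if "n \<le> T" for n
    using convexD[OF convex_cball[of 0 a], of "fdiff (fst k) n" "fdiff (fst l) n" "1 - t" t] assms that
    by (simp add: fdiff_mix admissible_def)
  moreover have "(fst (mix t k l) (T + 1), snd (mix t k l)) \<in> S"
    using convexD[OF S_convex, of "(fst k (T + 1), snd k)" "(fst l (T + 1), snd l)" "1 - t" t] assms
    by (simp add: fst_mix snd_mix admissible_def)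
  ultimately show ?thesis using assms by (simp add: admissible_def fst_mix)
qed

lemma norm_path_le:
  assumes "k \<in> admissible"
  shows "norm (fst k n) \<le> real (T + 1) * a"
proof (cases "n \<le> T + 1")
  case True
  then have "norm (fst k n) \<le> real n * a"
  proof (induction n)
    case (Suc n)
    have "norm (fst k (Suc n)) \<le> norm (fst k n) + norm (fdiff (fst k) n)"
      unfolding fdiff_def by (rule norm_triangle_sub)
    moreover have "norm (fdiff (fst k) n) \<le> a" using assms Suc.prems by (simp add: admissible_def)
    ultimately show ?case using Suc by (simp add: algebra_simps)
  qed (use assms in \<open>simp add: admissible_def\<close>)
  moreover have "real n * a \<le> real (T + 1) * a" using True a_pos by (intro mult_right_mono) auto
  ultimately show ?thesis by linarith
qed (use assms a_pos in \<open>simp add: admissible_def\<close>)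

lemma compact_admissible: "compact admissible"
proof -
  let ?L = "real (T + 1) * a"
  have "compactin (product_topology (\<lambda>i. euclidean) UNIV) (PiE (UNIV :: nat set) (\<lambda>n. cball (0::'v) ?L))"
    by (simp add: compactin_PiE)
  then have "compact (PiE (UNIV :: nat set) (\<lambda>n. cball (0::'v) ?L))"
    by (simp add: euclidean_product_topology)
  then have "compact (PiE (UNIV :: nat set) (\<lambda>n. cball (0::'v) ?L) \<times> {0..M})"
    by (intro compact_Times) simp_all
  moreover have "closed admissible"
  proof -
    have "closed ((\<lambda>k. (fst k (T + 1), snd k)) -` S :: ((nat \<Rightarrow> 'v) \<times> real) set)"
      by (intro closed_vimage S_closed continuous_intros)
    then show ?thesis
      unfolding admissible_def
      by (intro closed_Collect_conj closed_Collect_all closed_Collect_imp closed_Collect_eq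
          closed_Collect_le open_Collect_const continuous_intros) (simp add: vimage_def)
  qed
  moreover have "admissible \<subseteq> PiE UNIV (\<lambda>n. cball 0 ?L) \<times> {0..M}"
  proof
    fix k assume k: "k \<in> admissible"
    then have "0 \<le> snd k \<and> snd k \<le> M" using S_bounds[of "fst k (T + 1)" "snd k"] by (simp add: admissible_def)
    then show "k \<in> PiE UNIV (\<lambda>n. cball 0 ?L) \<times> {0..M}"
      using norm_path_le[OF k] by (cases k) (auto simp: PiE_iff)
  qed
  ultimately show ?thesis by (metis compact_Int_closed inf.absorb_iff2)
qed

lemma continuous_on_convex_energy [continuous_intros]: 
  assumes "continuous_on X p" "p ` X \<subseteq> admissible"
  shows "continuous_on X (\<lambda>x. convex_energy (p x))"
  unfolding convex_energy_def
  by (intro continuous_intros continuous_on_compose2[OF Phi_cont] assms)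
     (use assms(2) in \<open>auto simp: admissible_def image_subset_iff\<close>)

lemma convex_energy_mix_le:
  assumes "k \<in> admissible" "l \<in> admissible" "0 \<le> t" "t \<le> 1"
  shows "convex_energy (mix t k l) \<le> (1 - t) * convex_energy k + t * convex_energy l"
proof -
  have "(\<Sum>n\<le>T. \<Phi> (fdiff (fst (mix t k l)) n))
     \<le> (\<Sum>n\<le>T. (1 - t) * \<Phi> (fdiff (fst k) n) + t * \<Phi> (fdiff (fst l) n))"
    unfolding fdiff_mix using assms by (intro sum_mono Phi_convex_le) (auto simp: admissible_def)
  also have "\<dots> = (1 - t) * (\<Sum>n\<le>T. \<Phi> (fdiff (fst k) n)) + t * (\<Sum>n\<le>T. \<Phi> (fdiff (fst l) n))"
    by (simp add: sum.distrib sum_distrib_left)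
  finally show ?thesis by (simp add: convex_energy_def snd_mix algebra_simps)
qed

lemma convex_energy_mix_less:
  assumes "k \<in> admissible" "l \<in> admissible" "0 < t" "t < 1" "fst k \<noteq> fst l"
  shows "convex_energy (mix t k l) < (1 - t) * convex_energy k + t * convex_energy l"
proof -
  have "\<exists>n\<le>T. fdiff (fst k) n \<noteq> fdiff (fst l) n"
  proof (rule ccontr)
    assume eq: "\<not> ?thesis"
    have "n \<le> T + 1 \<Longrightarrow> fst k n = fst l n" for n
    proof (induction n)
      case (Suc n)
      then have "fdiff (fst k) n = fdiff (fst l) n" "fst k n = fst l n" using eq by auto
      then show ?case by (simp add: fdiff_def)
    qed (use assms in \<open>simp add: admissible_def\<close>)
    moreover have "n > T + 1 \<Longrightarrow> fst k n = fst l n" for n using assms by (simp add: admissible_def)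
    ultimately have "fst k n = fst l n" for n by (cases "n \<le> T + 1") auto
    then show False using assms(5) by blast
  qed
  then obtain m where m: "m \<le> T" "fdiff (fst k) m \<noteq> fdiff (fst l) m" by blast
  have "(\<Sum>n\<le>T. \<Phi> (fdiff (fst (mix t k l)) n))
     < (\<Sum>n\<le>T. (1 - t) * \<Phi> (fdiff (fst k) n) + t * \<Phi> (fdiff (fst l) n))"
  proof (rule sum_strict_mono_ex1)
    show "\<forall>n\<in>{..T}. \<Phi> (fdiff (fst (mix t k l)) n)
        \<le> (1 - t) * \<Phi> (fdiff (fst k) n) + t * \<Phi> (fdiff (fst l) n)"
      unfolding fdiff_mix using assms by (intro ballI Phi_convex_le) (auto simp: admissible_def)
    have "\<Phi> (fdiff (fst (mix t k l)) m)
        < (1 - t) * \<Phi> (fdiff (fst k) m) + t * \<Phi> (fdiff (fst l) m)"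
      unfolding fdiff_mix using assms m Phi_convex
      by (auto simp: admissible_def strictly_convex_on_def)
    then show "\<exists>n\<in>{..T}. \<Phi> (fdiff (fst (mix t k l)) n)
        < (1 - t) * \<Phi> (fdiff (fst k) n) + t * \<Phi> (fdiff (fst l) n)"
      using m(1) by auto
  qed simp
  also have "\<dots> = (1 - t) * (\<Sum>n\<le>T. \<Phi> (fdiff (fst k) n)) + t * (\<Sum>n\<le>T. \<Phi> (fdiff (fst l) n))"
    by (simp add: sum.distrib sum_distrib_left)
  finally show ?thesis by (simp add: convex_energy_def snd_mix algebra_simps)
qed

lemma pairing_mix:
  "(\<Sum>n=1..T. w n \<bullet> fst (mix t k l) n) =
     (1 - t) * (\<Sum>n=1..T. w n \<bullet> fst k n) + t * (\<Sum>n=1..T. w n \<bullet> fst l n)"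
  by (simp add: fst_mix inner_add_right sum.distrib sum_distrib_left)

lemma minimizer_exists: "\<exists>k\<in>admissible. \<forall>l\<in>admissible. tilted_energy w k \<le> tilted_energy w l"
proof (rule continuous_attains_inf[OF compact_admissible])
  show "continuous_on admissible (tilted_energy w)"
    unfolding tilted_energy_def[abs_def] by (intro continuous_intros) auto
qed (use zero_admissible in auto)

lemma minimizer_unique:
  assumes "k \<in> admissible" "\<And>k'. k' \<in> admissible \<Longrightarrow> tilted_energy w k \<le> tilted_energy w k'"
    and "l \<in> admissible" "\<And>k'. k' \<in> admissible \<Longrightarrow> tilted_energy w l \<le> tilted_energy w k'"
  shows "k = l"
proof -
  have eq: "tilted_energy w k = tilted_energy w l" using assms by (intro antisym) auto
  have "fst k = fst l"
  proof (rule ccontr)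
    assume "fst k \<noteq> fst l"
    then have "convex_energy (mix (1/2) k l) < 1/2 * convex_energy k + 1/2 * convex_energy l"
      using convex_energy_mix_less[of k l "1/2"] assms by simp
    then have "tilted_energy w (mix (1/2) k l) < tilted_energy w k"
      using eq unfolding tilted_energy_def pairing_mix by simp
    moreover have "tilted_energy w k \<le> tilted_energy w (mix (1/2) k l)" using assms mix_admissible by simp
    ultimately show False by simp
  qed
  moreover from this have "snd k = snd l" using eq by (simp add: tilted_energy_def convex_energy_def)
  ultimately show ?thesis by (rule prod_eqI)
qed

text \<open>
  A minimizer with an increment of norm \<open>a\<close> could be improved by shrinking the whole path towards
  zero: the infinite slope of \<open>\<Phi>\<close> outweighs the linear term, and no other term increases.
\<close>

lemma minimizer_interior:
  assumes k: "k \<in> admissible"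
    and min: "\<And>l. l \<in> admissible \<Longrightarrow> tilted_energy w k \<le> tilted_energy w l"
    and "m \<le> T"
  shows "norm (fdiff (fst k) m) < a"
proof (rule ccontr)
  assume "\<not> ?thesis"
  then have "norm (fdiff (fst k) m) = a" using k \<open>m \<le> T\<close> by (force simp: admissible_def)
  from phi_inner_unbounded[OF this, of "\<Sum>n=1..T. w n \<bullet> fst k n"]
  obtain t where t: "0 < t" "t < 1"
    and big: "(\<Sum>n=1..T. w n \<bullet> fst k n) < \<phi> ((1 - t) *\<^sub>R fdiff (fst k) m) \<bullet> fdiff (fst k) m"
    by blast
  let ?l = "mix t k (\<lambda>n. 0, 0)"
  let ?i = "\<lambda>n. \<phi> ((1 - t) *\<^sub>R fdiff (fst k) n) \<bullet> fdiff (fst k) n"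
  have dl: "fdiff (fst ?l) n = (1 - t) *\<^sub>R fdiff (fst k) n" for n
    by (simp add: fdiff_mix) (simp add: fdiff_def)
  have ball: "(1 - t) *\<^sub>R fdiff (fst k) n \<in> ball 0 a" if "n \<le> T" for n
  proof -
    have "norm ((1 - t) *\<^sub>R fdiff (fst k) n) \<le> (1 - t) * a"
      using k that t by (simp add: admissible_def)
    also have "\<dots> < a" using t a_pos by (simp add: algebra_simps)
    finally show ?thesis by simp
  qed
  have nonneg: "0 \<le> ?i n" if "n \<le> T" for n
    using phi_inner_nonneg[OF ball[OF that]] t by (simp add: zero_le_mult_iff)
  have step: "\<Phi> (fdiff (fst ?l) n) \<le> \<Phi> (fdiff (fst k) n) - t * ?i n" if "n \<le> T" for n
  proof -
    have "fdiff (fst k) n - (1 - t) *\<^sub>R fdiff (fst k) n = t *\<^sub>R fdiff (fst k) n"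
      by (simp add: algebra_simps)
    then show ?thesis
      using Phi_gradient_le[OF ball[OF that], of "fdiff (fst k) n"] k that
      by (simp add: dl admissible_def)
  qed
  have "?i m \<le> (\<Sum>n\<le>T. ?i n)"
    using nonneg \<open>m \<le> T\<close> by (intro member_le_sum) auto
  moreover have "(\<Sum>n\<le>T. \<Phi> (fdiff (fst ?l) n)) \<le> (\<Sum>n\<le>T. \<Phi> (fdiff (fst k) n)) - t * (\<Sum>n\<le>T. ?i n)"
    unfolding sum_distrib_left sum_subtractf[symmetric] using step by (intro sum_mono) auto
  moreover have "snd ?l \<le> snd k"
    using k S_bounds[of "fst k (T + 1)" "snd k"] t by (simp add: snd_mix admissible_def mult_left_le_one_le)
  moreover have "tilted_energy w k \<le> tilted_energy w ?l"
    using min mix_admissible[OF k zero_admissible] t by simp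
  ultimately have "t * (\<Sum>n\<le>T. ?i n) \<le> t * (\<Sum>n=1..T. w n \<bullet> fst k n)"
    and "?i m \<le> (\<Sum>n\<le>T. ?i n)"
    unfolding tilted_energy_def convex_energy_def pairing_mix by (simp_all add: left_diff_distrib)
  then have "?i m \<le> (\<Sum>n=1..T. w n \<bullet> fst k n)" using t(1) by simp
  then show False using big by simp
qed

text \<open>
  The variational inequality of the tilted problem, for perturbations \<open>e\<close> of the path of arbitrary size:
  small multiples of \<open>e\<close> are admissible because the increments are strictly inside the ball.
\<close>

lemma minimizer_variational:
  assumes k: "k \<in> admissible"
    and min: "\<And>l. l \<in> admissible \<Longrightarrow> tilted_energy w k \<le> tilted_energy w l"
    and e: "e 0 = 0" "\<And>n. n > T + 1 \<Longrightarrow> e n = 0" "(fst k (T + 1) + e (T + 1), r) \<in> S"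
  shows "0 \<le> (\<Sum>n\<le>T. \<phi> (fdiff (fst k) n) \<bullet> fdiff e n) + (r - snd k) - (\<Sum>n=1..T. w n \<bullet> e n)"
proof (rule ccontr)
  assume neg: "\<not> ?thesis"
  define l where "l t = (\<lambda>n. fst k n + t *\<^sub>R e n, snd k + t * (r - snd k))" for t
  have dl: "fdiff (fst (l t)) n = fdiff (fst k) n + t *\<^sub>R fdiff e n" for t n
    by (simp add: l_def fdiff_def algebra_simps)
  have "\<forall>\<^sub>F t in at_right 0. \<forall>n\<in>{..T}. norm (fdiff (fst k) n + t *\<^sub>R fdiff e n) < a"
  proof (intro eventually_ball_finite ballI)
    fix n assume n: "n \<in> {..T}"
    have "((\<lambda>t. norm (fdiff (fst k) n + t *\<^sub>R fdiff e n)) \<longlongrightarrow>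
        norm (fdiff (fst k) n + 0 *\<^sub>R fdiff e n)) (at_right 0)"
      by (intro tendsto_intros)
    then show "\<forall>\<^sub>F t in at_right 0. norm (fdiff (fst k) n + t *\<^sub>R fdiff e n) < a"
      using minimizer_interior[OF k min] n by (intro order_tendstoD(2)) auto
  qed simp
  then have "\<forall>\<^sub>F t in at_right 0. l t \<in> admissible"
    using eventually_at_right_real[of 0 "1::real", OF zero_less_one]
  proof eventually_elim
    case (elim t)
    have "(1 - t) *\<^sub>R (fst k (T + 1), snd k) + t *\<^sub>R (fst k (T + 1) + e (T + 1), r) \<in> S"
      using k e(3) elim(2) by (intro convexD[OF S_convex]) (auto simp: admissible_def)
    then have "(fst (l t) (T + 1), snd (l t)) \<in> S"
      by (simp add: l_def algebra_simps)
    then show ?case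
      using elim k e by (auto simp: admissible_def dl less_imp_le) (simp_all add: l_def)
  qed
  then have "\<forall>\<^sub>F t in at_right 0. tilted_energy w k \<le> tilted_energy w (l t)"
    by eventually_elim (rule min)
  then obtain b where b: "b > 0" "\<And>t. 0 < t \<Longrightarrow> t < b \<Longrightarrow> tilted_energy w k \<le> tilted_energy w (l t)"
    by (auto simp: eventually_at_right_field)
  have Ql: "tilted_energy w (l t) = (\<Sum>n\<le>T. \<Phi> (fdiff (fst k) n + t *\<^sub>R fdiff e n)) + (snd k + t * (r - snd k))
      - ((\<Sum>n=1..T. w n \<bullet> fst k n) + t * (\<Sum>n=1..T. w n \<bullet> e n))" for t
    by (simp add: tilted_energy_def convex_energy_def dl) (simp add: l_def inner_add_right sum.distrib sum_distrib_left)
  have "((\<lambda>t. \<Phi> (fdiff (fst k) n + t *\<^sub>R fdiff e n)) has_real_derivative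
      \<phi> (fdiff (fst k) n) \<bullet> fdiff e n) (at 0)" if "n \<le> T" for n
    using minimizer_interior[OF k min that] by (intro GDERIV_along_line) (auto intro: phi_grad)
  then have "((\<lambda>t. tilted_energy w (l t)) has_real_derivative
      (\<Sum>n\<le>T. \<phi> (fdiff (fst k) n) \<bullet> fdiff e n) + (r - snd k) - (\<Sum>n=1..T. w n \<bullet> e n)) (at 0)"
    unfolding Ql by (auto intro!: derivative_eq_intros)
  from DERIV_neg_dec_right[OF this] neg
  obtain d where d: "d > 0" "\<And>t. 0 < t \<Longrightarrow> t < d \<Longrightarrow> tilted_energy w (l (0 + t)) < tilted_energy w (l 0)"
    by auto
  define t where "t = min b d / 2"
  have "0 < t" "t < b" "t < d" using b(1) d(1) by (auto simp: t_def min_def)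
  moreover have "l 0 = k" by (simp add: l_def)
  ultimately show False using b(2)[of t] d(2)[of t] by simp
qed

lemma sum_fdiff_single:
  fixes g :: "nat \<Rightarrow> 'v"
  assumes "1 \<le> m" "m \<le> T + 1"
  shows "(\<Sum>n\<le>T. g n \<bullet> fdiff (\<lambda>n. if n = m then v else 0) n) =
     g (m - 1) \<bullet> v - (if m \<le> T then g m \<bullet> v else 0)"
proof -
  have "(\<Sum>n\<le>T. g n \<bullet> fdiff (\<lambda>n. if n = m then v else 0) n) =
      (\<Sum>n\<le>T. (if n = m - 1 then g n \<bullet> v else 0) - (if n = m then g n \<bullet> v else 0))"
    using assms by (intro sum.cong) (auto simp: fdiff_def)
  also have "\<dots> = g (m - 1) \<bullet> v - (if m \<le> T then g m \<bullet> v else 0)"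
    unfolding sum_subtractf using assms by (subst sum.delta, simp)+ (auto simp: Suc_le_eq)
  finally show ?thesis .
qed

lemma minimizer_difference_equation:
  assumes k: "k \<in> admissible"
    and min: "\<And>l. l \<in> admissible \<Longrightarrow> tilted_energy w k \<le> tilted_energy w l"
    and m: "m \<in> {1..T}"
  shows "\<phi> (fdiff (fst k) (m - 1)) - \<phi> (fdiff (fst k) m) = w m"
proof -
  define d where "d = \<phi> (fdiff (fst k) (m - 1)) - \<phi> (fdiff (fst k) m) - w m"
  let ?e = "\<lambda>n. if n = m then - d else 0"
  have "0 \<le> (\<Sum>n\<le>T. \<phi> (fdiff (fst k) n) \<bullet> fdiff ?e n) + (snd k - snd k) - (\<Sum>n=1..T. w n \<bullet> ?e n)"
    using m k by (intro minimizer_variational k min) (auto simp: admissible_def)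
  also have "(\<Sum>n=1..T. w n \<bullet> ?e n) = (\<Sum>n=1..T. if n = m then w n \<bullet> (- d) else 0)"
    by (intro sum.cong) auto
  also have "\<dots> = w m \<bullet> (- d)" using m by simp
  finally have "0 \<le> - (d \<bullet> d)"
    using m sum_fdiff_single[of m "\<lambda>n. \<phi> (fdiff (fst k) n)" "- d"]
    by (simp add: d_def[THEN arg_cong[where f = "\<lambda>u. u \<bullet> d"]] inner_diff_left)
  then have "d \<bullet> d = 0" using inner_ge_zero[of d] by linarith
  then have "d = 0" by simp
  then show ?thesis by (simp add: d_def)
qed

lemma minimizer_boundary_inequality:
  assumes k: "k \<in> admissible"
    and min: "\<And>l. l \<in> admissible \<Longrightarrow> tilted_energy w k \<le> tilted_energy w l"
    and "(v, r) \<in> S"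
  shows "snd k - \<phi> (fdiff (fst k) T) \<bullet> (v - fst k (T + 1)) \<le> r"
proof -
  let ?e = "\<lambda>n. if n = T + 1 then v - fst k (T + 1) else 0"
  have "0 \<le> (\<Sum>n\<le>T. \<phi> (fdiff (fst k) n) \<bullet> fdiff ?e n) + (r - snd k) - (\<Sum>n=1..T. w n \<bullet> ?e n)"
    using assms by (intro minimizer_variational k min) auto
  also have "(\<Sum>n=1..T. w n \<bullet> ?e n) = 0" by (intro sum.neutral) auto
  finally show ?thesis
    using sum_fdiff_single[of "T + 1" "\<lambda>n. \<phi> (fdiff (fst k) n)" "v - fst k (T + 1)"] by simp
qed

end

section \<open>Existence of a critical point\<close>

text \<open>
  In the rest of the argument a state is \<open>z = (x, y, r)\<close> where \<open>(y, r)\<close> is admissible, and it stands for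
  the path \<open>u n = x + y n\<close>. The constant \<open>(T + 1) * a\<close> bounds the norm of all values \<open>y n\<close>.
\<close>

locale coercive_system = singular_energy T a M \<phi> \<Phi> S
  for T :: nat and a M :: real and \<phi> :: "'v::euclidean_space \<Rightarrow> 'v" and \<Phi> :: "'v \<Rightarrow> real"
    and S :: "('v \<times> real) set" +
  fixes G :: "nat \<Rightarrow> 'v \<Rightarrow> real" and g :: "nat \<Rightarrow> 'v \<Rightarrow> 'v"
  assumes G_grad: "\<And>n v. n \<in> {1..T} \<Longrightarrow> GDERIV (G n) v :> g n v"
    and g_cont: "\<And>n. n \<in> {1..T} \<Longrightarrow> continuous_on UNIV (g n)"
    and G_coercive: "\<And>Z. \<exists>R. \<forall>x y. R \<le> norm x \<longrightarrow> (\<forall>n. norm (y n) \<le> real (T + 1) * a) \<longrightarrow>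
      Z \<le> (\<Sum>n=1..T. G n (x + y n))"
begin

text \<open>The forces acting along the path.\<close>

definition force :: "'v \<times> (nat \<Rightarrow> 'v) \<times> real \<Rightarrow> nat \<Rightarrow> 'v" where
  "force z n = g n (fst z + fst (snd z) n)"

text \<open>The smooth part of the action, up to sign.\<close>

definition potential :: "'v \<times> (nat \<Rightarrow> 'v) \<times> real \<Rightarrow> real" where
  "potential z = (\<Sum>n=1..T. G n (fst z + fst (snd z) n))"

text \<open>The functional whose critical points are sought.\<close>

definition action :: "'v \<times> (nat \<Rightarrow> 'v) \<times> real \<Rightarrow> real" where
  "action z = convex_energy (snd z) - potential z"

text \<open>The minimizer of the convex energy tilted by the forces at \<open>z\<close>.\<close>

definition reply :: "'v \<times> (nat \<Rightarrow> 'v) \<times> real \<Rightarrow> (nat \<Rightarrow> 'v) \<times> real" where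
  "reply z = (SOME k. k \<in> admissible \<and>
     (\<forall>l\<in>admissible. tilted_energy (force z) k \<le> tilted_energy (force z) l))"

text \<open>The gradient of the potential in the variable \<open>x\<close>.\<close>

definition total_force :: "'v \<times> (nat \<Rightarrow> 'v) \<times> real \<Rightarrow> 'v" where
  "total_force z = (\<Sum>n=1..T. force z n)"

text \<open>
  A lower bound for the rate at which the action decreases when \<open>x\<close> moves along the total force and
  \<open>(y, r)\<close> moves towards the reply. On admissible states it is nonnegative, and it vanishes exactly at critical points.
\<close>

definition slope :: "'v \<times> (nat \<Rightarrow> 'v) \<times> real \<Rightarrow> real" where
  "slope z = total_force z \<bullet> total_force z +
     (tilted_energy (force z) (snd z) - tilted_energy (force z) (reply z))"

text \<open>The velocity of the value \<open>u n\<close> under this motion.\<close>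

definition velocity :: "'v \<times> (nat \<Rightarrow> 'v) \<times> real \<Rightarrow> nat \<Rightarrow> 'v" where
  "velocity z n = total_force z + (fst (reply z) n - fst (snd z) n)"

text \<open>The state reached from \<open>z\<close> after the time step \<open>t\<close>.\<close>

definition move :: "real \<Rightarrow> 'v \<times> (nat \<Rightarrow> 'v) \<times> real \<Rightarrow> 'v \<times> (nat \<Rightarrow> 'v) \<times> real" where
  "move t z = (fst z + t *\<^sub>R total_force z, mix t (snd z) (reply z))"

lemma reply_admissible: "reply z \<in> admissible"
  and reply_min: "l \<in> admissible \<Longrightarrow> tilted_energy (force z) (reply z) \<le> tilted_energy (force z) l"
proof -
  let ?min = "\<lambda>k. k \<in> admissible \<and> (\<forall>l\<in>admissible. tilted_energy (force z) k \<le> tilted_energy (force z) l)"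
  have "\<exists>k. ?min k" using minimizer_exists by blast
  then have "?min (reply z)" unfolding reply_def by (rule someI_ex)
  then show "reply z \<in> admissible"
    "l \<in> admissible \<Longrightarrow> tilted_energy (force z) (reply z) \<le> tilted_energy (force z) l"
    by auto
qed

lemma reply_unique:
  assumes "k \<in> admissible" "\<And>l. l \<in> admissible \<Longrightarrow> tilted_energy (force z) k \<le> tilted_energy (force z) l"
  shows "k = reply z"
  using assms
  by (rule minimizer_unique[of k "force z" "reply z"]) (assumption | rule reply_admissible reply_min | blast)+

lemma continuous_on_force:
  assumes "continuous_on X p" "n \<in> {1..T}"
  shows "continuous_on X (\<lambda>x. force (p x) n)"
  unfolding force_def
  by (rule continuous_on_compose2[OF g_cont[OF assms(2)]])
     (auto intro!: continuous_on_add continuous_on_fst continuous_on_fst_coordinate continuous_on_snd assms)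

lemma continuous_on_potential:
  assumes "continuous_on X p"
  shows "continuous_on X (\<lambda>x. potential (p x))"
proof -
  have G: "continuous_on UNIV (G n)" if "n \<in> {1..T}" for n
    using G_grad[OF that] unfolding gderiv_def
    by (meson continuous_at_imp_continuous_on has_derivative_continuous)
  have "continuous_on X (\<lambda>x. G n (fst (p x) + fst (snd (p x)) n))" if "n \<in> {1..T}" for n
    by (rule continuous_on_compose2[OF G[OF that]])
       (auto intro!: continuous_on_add continuous_on_fst continuous_on_fst_coordinate continuous_on_snd assms)
  then show ?thesis unfolding potential_def by (rule continuous_on_sum)
qed

lemma continuous_on_tilted_energy:
  assumes "continuous_on X p" "continuous_on X k" "k ` X \<subseteq> admissible"
  shows "continuous_on X (\<lambda>x. tilted_energy (force (p x)) (k x))"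
  unfolding tilted_energy_def
  by (intro continuous_on_diff continuous_on_convex_energy continuous_on_sum continuous_on_inner
      continuous_on_force continuous_on_fst_coordinate assms)

lemma continuous_on_reply: "continuous_on (UNIV \<times> admissible) reply"
proof (rule continuous_on_unique_minimizer[OF compact_admissible, where Q = "\<lambda>z. tilted_energy (force z)"])
  show "continuous_on ((UNIV \<times> admissible) \<times> admissible) (\<lambda>(z, k). tilted_energy (force z) k)"
    unfolding case_prod_beta
    by (intro continuous_on_tilted_energy continuous_on_fst continuous_on_snd continuous_on_id) auto
qed (use reply_admissible reply_min reply_unique in auto)

lemma continuous_on_total_force:
  assumes "continuous_on X p"
  shows "continuous_on X (\<lambda>x. total_force (p x))"
  unfolding total_force_def by (intro continuous_on_sum continuous_on_force assms)

lemma continuous_on_slope: "continuous_on (UNIV \<times> admissible) slope"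
  unfolding slope_def[abs_def]
  by (intro continuous_on_add continuous_on_inner continuous_on_diff continuous_on_total_force continuous_on_tilted_energy
      continuous_on_reply continuous_on_id continuous_on_snd) (use reply_admissible in auto)

lemma continuous_on_velocity: "continuous_on (UNIV \<times> admissible) (\<lambda>z. velocity z n)"
  unfolding velocity_def
  by (intro continuous_on_add continuous_on_diff continuous_on_total_force continuous_on_fst_coordinate
      continuous_on_reply continuous_on_id continuous_on_snd)

lemma move_in: "z \<in> UNIV \<times> admissible \<Longrightarrow> 0 \<le> t \<Longrightarrow> t \<le> 1 \<Longrightarrow> move t z \<in> UNIV \<times> admissible"
  using mix_admissible[OF _ reply_admissible] by (auto simp: move_def)

lemma continuous_on_move:
  assumes "continuous_on (UNIV \<times> admissible) \<sigma>"
  shows "continuous_on (UNIV \<times> admissible) (\<lambda>z. move (\<sigma> z) z)"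
  unfolding move_def
  by (intro continuous_on_Pair continuous_on_add continuous_on_scaleR continuous_on_fst continuous_on_total_force
      continuous_on_mix continuous_on_snd continuous_on_reply continuous_on_id assms)

lemma action_move_le:
  assumes z: "z \<in> UNIV \<times> admissible" "norm (fst z) \<le> R" and t: "0 \<le> t" "t \<le> 1"
    and small: "t * (\<Sum>n=1..T. norm (velocity z n)) \<le> \<delta>"
    and \<delta>: "\<And>n p v. n \<in> {1..T} \<Longrightarrow> p \<in> cball 0 (R + real (T + 1) * a) \<Longrightarrow> norm v \<le> \<delta> \<Longrightarrow>
        G n p + g n p \<bullet> v - \<epsilon> * norm v \<le> G n (p + v)"
  shows "action (move t z) \<le> action z - t * (slope z - \<epsilon> * (\<Sum>n=1..T. norm (velocity z n)))"
proof -
  let ?p = "\<lambda>n. fst z + fst (snd z) n"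
  have adm: "snd z \<in> admissible" using z by auto
  have pos: "fst (move t z) + fst (snd (move t z)) n = ?p n + t *\<^sub>R velocity z n" for n
    by (simp add: move_def fst_mix velocity_def algebra_simps)
  have "G n (?p n) + t * (force z n \<bullet> velocity z n) - \<epsilon> * (t * norm (velocity z n))
      \<le> G n (?p n + t *\<^sub>R velocity z n)" if n: "n \<in> {1..T}" for n
  proof -
    have "norm (velocity z n) \<le> (\<Sum>n=1..T. norm (velocity z n))"
      using n by (intro member_le_sum) auto
    then have "t * norm (velocity z n) \<le> \<delta>" using small t by (meson mult_left_mono order_trans)
    moreover have "norm (?p n) \<le> R + real (T + 1) * a"
      using norm_triangle_ineq[of "fst z" "fst (snd z) n"] norm_path_le[OF adm, of n] z(2) by linarith
    ultimately show ?thesis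
      using \<delta>[OF n, of "?p n" "t *\<^sub>R velocity z n"] t by (simp add: force_def)
  qed
  then have "(\<Sum>n=1..T. G n (?p n) + t * (force z n \<bullet> velocity z n) - \<epsilon> * (t * norm (velocity z n)))
      \<le> potential (move t z)"
    unfolding potential_def pos by (intro sum_mono)
  then have "potential z + t * (\<Sum>n=1..T. force z n \<bullet> velocity z n) - \<epsilon> * (t * (\<Sum>n=1..T. norm (velocity z n)))
      \<le> potential (move t z)"
    by (simp add: potential_def sum.distrib sum_subtractf sum_distrib_left)
  moreover have inner: "(\<Sum>n=1..T. force z n \<bullet> velocity z n) = total_force z \<bullet> total_force z +
      ((\<Sum>n=1..T. force z n \<bullet> fst (reply z) n) - (\<Sum>n=1..T. force z n \<bullet> fst (snd z) n))"
    by (simp add: velocity_def inner_add_right inner_diff_right sum.distrib sum_subtractf total_force_def inner_sum_left)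
  moreover have "convex_energy (snd (move t z)) \<le>
      convex_energy (snd z) + t * (convex_energy (reply z) - convex_energy (snd z))"
    using convex_energy_mix_le[OF adm reply_admissible t, of z] by (simp add: move_def algebra_simps)
  moreover have "t * slope z = t * (\<Sum>n=1..T. force z n \<bullet> velocity z n)
      - t * (convex_energy (reply z) - convex_energy (snd z))"
    unfolding inner by (simp add: slope_def tilted_energy_def algebra_simps)
  ultimately show ?thesis by (simp add: action_def algebra_simps)
qed

text \<open>
  A state that is its own reply and has vanishing total force. Without one, the slope has a positive lower
  bound where \<open>|x|\<close> is bounded, and iterating \<open>move\<close> contradicts Brouwer's theorem.
\<close>

theorem critical_point_exists:
  "\<exists>x k. k \<in> admissible \<and>
     (\<forall>l\<in>admissible. tilted_energy (force (x, k)) k \<le> tilted_energy (force (x, k)) l) \<and>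
     (\<Sum>n=1..T. force (x, k) n) = 0"
proof (rule ccontr)
  assume none: "\<not> ?thesis"
  have slope_pos: "0 < slope z" if "z \<in> UNIV \<times> admissible" for z
  proof (rule ccontr)
    assume "\<not> 0 < slope z"
    moreover have "0 \<le> tilted_energy (force z) (snd z) - tilted_energy (force z) (reply z)" using reply_min that by auto
    moreover have "0 \<le> total_force z \<bullet> total_force z" by simp
    ultimately have "total_force z \<bullet> total_force z = 0"
      and attained: "tilted_energy (force z) (snd z) = tilted_energy (force z) (reply z)"
      unfolding slope_def by linarith+
    then have "(\<Sum>n=1..T. force z n) = 0" by (simp add: total_force_def)
    moreover have "\<forall>l\<in>admissible. tilted_energy (force z) (snd z) \<le> tilted_energy (force z) l"
      using reply_min attained by simp
    ultimately show False using none that by (metis mem_Times_iff prod.collapse)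
  qed
  have "continuous_on admissible (\<lambda>k. action (0, k))"
    unfolding action_def snd_conv
    by (intro continuous_on_diff continuous_on_convex_energy continuous_on_potential continuous_on_Pair
        continuous_on_const continuous_on_id) auto
  then obtain m where m: "\<And>k. k \<in> admissible \<Longrightarrow> m \<le> action (0, k)"
    using continuous_attains_inf[OF compact_admissible] zero_admissible by blast
  have "continuous_on admissible convex_energy" by (rule continuous_on_convex_energy) auto
  then obtain b where b: "\<And>k. k \<in> admissible \<Longrightarrow> convex_energy k \<le> b"
    using continuous_attains_sup[OF compact_admissible] zero_admissible by blast
  obtain R0 where R0: "\<And>x y. R0 \<le> norm x \<Longrightarrow> (\<And>n. norm (y n) \<le> real (T + 1) * a) \<Longrightarrow>
      b - m + 1 \<le> (\<Sum>n=1..T. G n (x + y n))"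
    using G_coercive[of "b - m + 1"] by blast
  define R1 where "R1 = max 1 R0"
  define R2 where "R2 = R1 + 1"
  have R2: "R2 > 0" by (simp add: R2_def R1_def)
  have far: "action z < m" if "z \<in> UNIV \<times> admissible" "R1 \<le> norm (fst z)" for z
  proof -
    have k: "snd z \<in> admissible" using that by auto
    have "b - m + 1 \<le> potential z"
      unfolding potential_def using that by (intro R0 norm_path_le[OF k]) (simp add: R1_def)
    then show ?thesis using b[OF k] by (simp add: action_def)
  qed
  let ?C = "cball (0::'v) R2 \<times> admissible"
  have C: "compact ?C" by (intro compact_Times compact_cball compact_admissible)
  have "(0, (\<lambda>n. 0, 0)) \<in> ?C" using R2 zero_admissible by simp
  then have C_ne: "?C \<noteq> {}" by blast
  have sub: "?C \<subseteq> UNIV \<times> admissible" by auto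
  obtain z0 where z0: "z0 \<in> ?C" "\<And>z. z \<in> ?C \<Longrightarrow> slope z0 \<le> slope z"
    using continuous_attains_inf[OF C C_ne continuous_on_subset[OF continuous_on_slope sub]] by blast
  define q0 where "q0 = slope z0"
  have q0: "q0 > 0" using slope_pos z0(1) unfolding q0_def by blast
  have "continuous_on ?C (\<lambda>z. \<Sum>n=1..T. norm (velocity z n))"
    by (intro continuous_on_sum continuous_on_norm continuous_on_subset[OF continuous_on_velocity sub])
  from continuous_attains_sup[OF C C_ne this]
  obtain z1 where z1: "\<And>z. z \<in> ?C \<Longrightarrow> (\<Sum>n=1..T. norm (velocity z n)) \<le> (\<Sum>n=1..T. norm (velocity z1 n))"
    by blast
  define B where "B = 1 + (\<Sum>n=1..T. norm (velocity z1 n))"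
  have B: "B \<ge> 1" by (simp add: B_def sum_nonneg)
  have vel: "(\<Sum>n=1..T. norm (velocity z n)) \<le> B" if "z \<in> ?C" for z
    using z1[OF that] by (simp add: B_def)
  define \<epsilon> where "\<epsilon> = q0 / (2 * B)"
  have \<epsilon>: "\<epsilon> > 0" using q0 B by (simp add: \<epsilon>_def)
  have "\<exists>\<delta>>0. \<forall>p\<in>cball 0 (R2 + real (T + 1) * a). \<forall>v. norm v \<le> \<delta> \<longrightarrow>
      G n p + g n p \<bullet> v - \<epsilon> * norm v \<le> G n (p + v)" if "n \<in> {1..T}" for n
    using that by (intro GDERIV_uniform_lower_bound G_grad g_cont \<epsilon>)
  then obtain d where d: "\<And>n. n \<in> {1..T} \<Longrightarrow> d n > 0"
    "\<And>n p v. n \<in> {1..T} \<Longrightarrow> p \<in> cball 0 (R2 + real (T + 1) * a) \<Longrightarrow> norm v \<le> d n \<Longrightarrow>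
        G n p + g n p \<bullet> v - \<epsilon> * norm v \<le> G n (p + v)"
    by metis
  define \<delta> where "\<delta> = Min (insert 1 (d ` {1..T}))"
  have \<delta>: "\<delta> > 0" "\<And>n. n \<in> {1..T} \<Longrightarrow> \<delta> \<le> d n"
    using d(1) unfolding \<delta>_def by (simp_all del: Min_insert)
  define t0 where "t0 = min 1 (\<delta> / B)"
  have t0: "0 < t0" "t0 \<le> 1" "t0 * B \<le> \<delta>"
    using \<delta>(1) B by (auto simp: t0_def min_def field_simps)
  \<comment> \<open>The time step is \<open>t0\<close> for \<open>|x| \<le> R1\<close>, which covers all states of action at least \<open>m\<close>, and zero for
    \<open>|x| \<ge> R2\<close>, so that the boundary of the initial disc stays fixed.\<close>
  define \<sigma> where "\<sigma> z = t0 * max 0 (min 1 (R2 - norm (fst z)))" for z :: "'v \<times> (nat \<Rightarrow> 'v) \<times> real"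
  have \<sigma>: "0 \<le> \<sigma> z" "\<sigma> z \<le> t0" for z
    using t0 by (auto simp: \<sigma>_def mult_left_le)
  define \<eta> where "\<eta> z = move (\<sigma> z) z" for z
  have \<eta>_in: "\<eta> z \<in> UNIV \<times> admissible" if "z \<in> UNIV \<times> admissible" for z
    using that \<sigma>[of z] t0 unfolding \<eta>_def by (intro move_in) auto
  have \<eta>_cont: "continuous_on (UNIV \<times> admissible) \<eta>"
    unfolding \<eta>_def \<sigma>_def
    by (intro continuous_on_move continuous_on_mult continuous_on_max continuous_on_min continuous_on_diff
        continuous_on_const continuous_on_norm continuous_on_fst continuous_on_id)
  have \<eta>_id: "\<eta> z = z" if "R2 \<le> norm (fst z)" for z
    using that by (cases z) (simp add: \<eta>_def \<sigma>_def move_def mix_def)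
  have decrease: "action (\<eta> z) \<le> action z - \<sigma> z * (q0 / 2)" if z: "z \<in> UNIV \<times> admissible" for z
  proof (cases "R2 \<le> norm (fst z)")
    case True
    then show ?thesis by (simp add: \<eta>_id) (simp add: \<sigma>_def)
  next
    case False
    then have zC: "z \<in> ?C" using z by (cases z) auto
    have "\<sigma> z * (\<Sum>n=1..T. norm (velocity z n)) \<le> t0 * B"
      using \<sigma> vel[OF zC] t0 by (intro mult_mono) (auto intro: sum_nonneg)
    then have "action (\<eta> z) \<le> action z - \<sigma> z * (slope z - \<epsilon> * (\<Sum>n=1..T. norm (velocity z n)))"
      unfolding \<eta>_def using False z \<sigma>[of z] t0 \<delta>(2)
      by (intro action_move_le[where R = R2 and \<delta> = \<delta>] d(2)) force+
    also have "\<dots> \<le> action z - \<sigma> z * (q0 / 2)"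
    proof -
      have "\<epsilon> * (\<Sum>n=1..T. norm (velocity z n)) \<le> \<epsilon> * B"
        using vel[OF zC] \<epsilon> by (intro mult_left_mono) auto
      also have "\<dots> = q0 / 2" using B by (simp add: \<epsilon>_def)
      finally have "q0 / 2 \<le> slope z - \<epsilon> * (\<Sum>n=1..T. norm (velocity z n))"
        using z0(2)[OF zC] by (simp add: q0_def)
      from mult_left_mono[OF this \<sigma>(1)[of z]] show ?thesis by linarith
    qed
    finally show ?thesis .
  qed
  define k0 where "k0 = (\<lambda>n::nat. 0::'v, 0::real)"
  have k0: "k0 \<in> admissible" using zero_admissible by (simp add: k0_def)
  have "continuous_on (cball 0 R2) (\<lambda>x. action (x, k0))"
    unfolding action_def snd_conv
    by (intro continuous_on_diff continuous_on_const continuous_on_potential continuous_on_Pair continuous_on_id)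
  moreover have "cball (0::'v) R2 \<noteq> {}" using R2 by simp
  ultimately obtain x0 where x0: "\<And>x. x \<in> cball 0 R2 \<Longrightarrow> action (x, k0) \<le> action (x0, k0)"
    using continuous_attains_sup[OF compact_cball] by blast
  \<comment> \<open>The image of the disc \<open>|x| \<le> R2\<close>, \<open>y = 0\<close> after \<open>i\<close> steps.\<close>
  define \<gamma> where "\<gamma> i x = (\<eta> ^^ i) (x, k0)" for i x
  have \<gamma>_in: "\<gamma> i x \<in> UNIV \<times> admissible" for i x
    by (induction i) (use k0 \<eta>_in in \<open>auto simp: \<gamma>_def\<close>)
  have \<gamma>_cont: "continuous_on (cball 0 R2) (\<gamma> i)" for i
  proof (induction i)
    case 0
    show ?case by (simp add: \<gamma>_def continuous_on_Pair continuous_on_id continuous_on_const)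
  next
    case (Suc i)
    have "\<gamma> (Suc i) = (\<lambda>x. \<eta> (\<gamma> i x))" by (simp add: \<gamma>_def fun_eq_iff)
    then show ?case
      using continuous_on_compose2[OF \<eta>_cont Suc] \<gamma>_in by auto
  qed
  have \<gamma>_id: "\<gamma> i x = (x, k0)" if "norm x = R2" for i x
    by (induction i) (use that \<eta>_id in \<open>auto simp: \<gamma>_def\<close>)
  have below: "action (\<gamma> i x) < m \<or> action (\<gamma> i x) \<le> action (x0, k0) - real i * (t0 * (q0 / 2))"
    if x: "x \<in> cball 0 R2" for i x
  proof (induction i)
    case 0
    show ?case using x0[OF x] by (simp add: \<gamma>_def)
  next
    case (Suc i)
    have \<gamma>_Suc: "\<gamma> (Suc i) x = \<eta> (\<gamma> i x)" by (simp add: \<gamma>_def)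
    have dec: "action (\<gamma> (Suc i) x) \<le> action (\<gamma> i x) - \<sigma> (\<gamma> i x) * (q0 / 2)"
      unfolding \<gamma>_Suc by (rule decrease[OF \<gamma>_in])
    show ?case
    proof (cases "action (\<gamma> i x) < m")
      case True
      moreover have "0 \<le> \<sigma> (\<gamma> i x) * (q0 / 2)" using \<sigma> q0 by simp
      ultimately show ?thesis using dec by linarith
    next
      case False
      then have "norm (fst (\<gamma> i x)) < R1" using far[OF \<gamma>_in] by (meson not_le)
      then have "\<sigma> (\<gamma> i x) = t0" by (simp add: \<sigma>_def R2_def)
      then have "action (\<gamma> (Suc i) x) \<le> action (\<gamma> i x) - t0 * (q0 / 2)" using dec by simp
      moreover have "action (\<gamma> i x) \<le> action (x0, k0) - real i * (t0 * (q0 / 2))" using Suc False by blast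
      moreover have "real (Suc i) * (t0 * (q0 / 2)) = real i * (t0 * (q0 / 2)) + t0 * (q0 / 2)"
        by (simp add: distrib_right)
      ultimately show ?thesis by linarith
    qed
  qed
  obtain i where i: "action (x0, k0) - m < real i * (t0 * (q0 / 2))"
    using reals_Archimedean3[of "t0 * (q0 / 2)"] t0(1) q0 by (meson half_gt_zero mult_pos_pos)
  have "\<exists>x\<in>cball 0 R2. fst (\<gamma> i x) = 0"
    using R2 \<gamma>_cont \<gamma>_id
    by (intro continuous_map_fixing_sphere_has_zero continuous_on_fst) auto
  then obtain x where x: "x \<in> cball 0 R2" "fst (\<gamma> i x) = 0" by blast
  have "m \<le> action (\<gamma> i x)"
    using m[of "snd (\<gamma> i x)"] \<gamma>_in[of i x] x(2) by (cases "\<gamma> i x") auto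
  then show False using below[OF x(1), of i] i by linarith
qed

end

section \<open>Boundary functional, coercivity and singularity\<close>

lemma closed_epigraph:
  fixes j :: "'a::metric_space \<Rightarrow> ereal"
  assumes "lower_semicontinuous j"
  shows "closed {(z, r::real). j z \<le> ereal r}"
proof -
  have "j z \<le> ereal r"
    if lim: "p \<longlonglongrightarrow> (z, r)" and p: "\<And>i. j (fst (p i)) \<le> ereal (snd (p i))" for p z r
  proof (rule ccontr)
    assume "\<not> ?thesis"
    then have "ereal r < j z" by simp
    then obtain c where c: "ereal r < c" "c < j z" by (meson dense)
    have zlim: "(\<lambda>i. fst (p i)) \<longlonglongrightarrow> z" and rlim: "(\<lambda>i. snd (p i)) \<longlonglongrightarrow> r"
      using tendsto_fst[OF lim] tendsto_snd[OF lim] by simp_all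
    have "j z \<le> Liminf (at z) j" using assms by (simp add: lower_semicontinuous_def)
    then have "\<forall>\<^sub>F w in at z. c < j w" using c(2) by (auto simp: le_Liminf_iff)
    \<comment> \<open>The punctured neighbourhood in the lower limit may be filled in, as \<open>c < j z\<close>.\<close>
    then have "\<forall>\<^sub>F w in nhds z. c < j w"
      using c(2) by (auto simp: eventually_at_filter elim!: eventually_mono)
    then have "\<forall>\<^sub>F i in sequentially. c < j (fst (p i))"
      using zlim by (rule eventually_compose_filterlim)
    moreover have "\<forall>\<^sub>F i in sequentially. ereal (snd (p i)) < c"
      using tendsto_ereal[OF rlim] c(1) by (rule order_tendstoD)
    ultimately have "\<forall>\<^sub>F i in sequentially. False"
      by eventually_elim (use p in \<open>meson less_le_trans less_asym not_le\<close>)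
    then show False by simp
  qed
  then show ?thesis
    unfolding closed_sequential_limits by (auto simp: case_prod_beta)
qed

lemma convex_epigraph:
  fixes j :: "'a::real_vector \<Rightarrow> ereal"
  assumes "convex_ereal j"
  shows "convex {(z, r::real). j z \<le> ereal r}"
proof -
  have "j ((1 - t) *\<^sub>R x + t *\<^sub>R y) \<le> ereal ((1 - t) * p + t * q)"
    if "j x \<le> ereal p" "j y \<le> ereal q" "0 < t" "t < 1" for x y p q t
  proof -
    have "j ((1 - t) *\<^sub>R x + t *\<^sub>R y) \<le> ereal (1 - t) * j x + ereal t * j y"
      using assms that by (simp add: convex_ereal_def)
    also have "\<dots> \<le> ereal (1 - t) * ereal p + ereal t * ereal q"
      using that by (intro add_mono ereal_mult_left_mono) auto
    finally show ?thesis by simp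
  qed
  then show ?thesis
    unfolding convex_alt by (auto simp: le_less[of 0] le_less[of _ 1])
qed

text \<open>
  The integer multiples of \<open>v\<close> lie in \<open>C\<close>, so \<open>v\<close> is a direction of recession: \<open>x + v\<close> is the limit of
  convex combinations of \<open>x\<close> and \<open>n v\<close>.
\<close>

lemma closed_convex_add_recession:
  fixes C :: "'a::real_normed_vector set"
  assumes "closed C" "convex C" "x \<in> C" "\<And>n::nat. real n *\<^sub>R v \<in> C"
  shows "x + v \<in> C"
proof (rule Lim_in_closed_set[OF assms(1)])
  let ?c = "\<lambda>n. (1 - inverse (real (Suc n))) *\<^sub>R x + inverse (real (Suc n)) *\<^sub>R (real (Suc n) *\<^sub>R v)"
  have "?c n \<in> C" for n
    by (rule convexD[OF assms(2,3,4)]) (simp_all add: field_simps)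
  then show "\<forall>\<^sub>F n in sequentially. ?c n \<in> C" by simp
  have "(\<lambda>n. (1 - inverse (real (Suc n))) *\<^sub>R x + v) \<longlonglongrightarrow> (1 - 0) *\<^sub>R x + v"
    by (intro tendsto_intros LIMSEQ_inverse_real_of_nat)
  moreover have "?c = (\<lambda>n. (1 - inverse (real (Suc n))) *\<^sub>R x + v)"
    by (simp add: fun_eq_iff)
  ultimately show "?c \<longlonglongrightarrow> x + v" by simp
qed simp

lemma diagonal_translation_invariance:
  fixes j :: "'a::real_normed_vector \<times> 'a \<Rightarrow> ereal"
  assumes "convex_ereal j" "lower_semicontinuous j" "\<And>x. j (x, x) = 0"
  shows "j (x, y) = j (0, y - x)"
proof -
  let ?C = "{(z, r::real). j z \<le> ereal r}"
  have le: "j (x + s, y + s) \<le> j (x, y)" for x y s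
  proof (rule ereal_le_real)
    fix r assume "j (x, y) \<le> ereal r"
    then have "((x, y), r) + ((s, s), 0) \<in> ?C"
      using assms(3) by (intro closed_convex_add_recession closed_epigraph convex_epigraph assms) auto
    then show "j (x + s, y + s) \<le> ereal r" by simp
  qed
  show ?thesis using le[of x "- x" y] le[of 0 x "y - x"] by (intro antisym) simp_all
qed

text \<open>
  For \<open>|y n| \<le> L \<le> |x|\<close> and \<open>|x| \<ge> 1\<close> the mean value theorem bounds the change of the sum caused by \<open>y\<close> by a constant
  multiple of \<open>|x|\<^sup>\<alpha>\<close>, which the coercive sum dominates.
\<close>

lemma perturbed_sum_coercive:
  fixes G :: "nat \<Rightarrow> 'a::euclidean_space \<Rightarrow> real"
  assumes G: "\<And>n v. n \<in> {1..T} \<Longrightarrow> GDERIV (G n) v :> g n v"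
    and growth: "\<And>n v. n \<in> {1..T} \<Longrightarrow> norm (g n v) \<le> C * (norm v powr \<alpha> + 1)"
    and C: "C \<ge> 0" and \<alpha>: "\<alpha> \<ge> 0"
    and coercive: "filterlim (\<lambda>v. norm v powr (- \<alpha>) * (\<Sum>n=1..T. G n v)) at_top at_infinity"
  shows "\<exists>R. \<forall>x y. R \<le> norm x \<longrightarrow> (\<forall>n. norm (y n) \<le> L) \<longrightarrow> Z \<le> (\<Sum>n=1..T. G n (x + y n))"
proof -
  define D where "D = real T * (C * (2 powr \<alpha> + 1) * \<bar>L\<bar>)"
  have "\<forall>\<^sub>F v in at_infinity. \<bar>Z\<bar> + D \<le> norm v powr (- \<alpha>) * (\<Sum>n=1..T. G n v)"
    using coercive by (simp add: filterlim_at_top)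
  then obtain R where R: "\<And>v. R \<le> norm v \<Longrightarrow> \<bar>Z\<bar> + D \<le> norm v powr (- \<alpha>) * (\<Sum>n=1..T. G n v)"
    by (auto simp: eventually_at_infinity)
  have "Z \<le> (\<Sum>n=1..T. G n (x + y n))"
    if x: "max R (max 1 \<bar>L\<bar>) \<le> norm x" and y: "\<And>n. norm (y n) \<le> L" for x y
  proof -
    define X where "X = norm x powr \<alpha>"
    have X1: "X \<ge> 1" using x \<alpha> by (simp add: X_def ge_one_powr_ge_zero)
    have L0: "L \<ge> 0" using y[of 0] norm_ge_zero order_trans by blast
    have "G n x - C * (2 powr \<alpha> + 1) * \<bar>L\<bar> * X \<le> G n (x + y n)" if n: "n \<in> {1..T}" for n
    proof -
      obtain t where t: "t \<in> {0..1}" "G n (x + y n) = G n x + g n (x + t *\<^sub>R y n) \<bullet> y n"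
        using GDERIV_mean_value[OF G[OF n]] by blast
      have "norm (t *\<^sub>R y n) \<le> norm x"
        using t(1) y[of n] x L0 mult_left_le_one_le[of "norm (y n)" t] by simp
      then have "norm (x + t *\<^sub>R y n) \<le> 2 * norm x"
        using norm_triangle_ineq[of x "t *\<^sub>R y n"] by linarith
      then have "norm (x + t *\<^sub>R y n) powr \<alpha> \<le> (2 * norm x) powr \<alpha>"
        using \<alpha> by (intro powr_mono2) auto
      also have "\<dots> = 2 powr \<alpha> * X" by (simp add: powr_mult X_def)
      finally have "norm (x + t *\<^sub>R y n) powr \<alpha> + 1 \<le> (2 powr \<alpha> + 1) * X"
        using X1 by (simp add: distrib_right)
      then have "norm (g n (x + t *\<^sub>R y n)) \<le> C * ((2 powr \<alpha> + 1) * X)"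
        using growth[OF n] C by (meson mult_left_mono order_trans)
      then have "norm (g n (x + t *\<^sub>R y n)) * norm (y n) \<le> C * ((2 powr \<alpha> + 1) * X) * \<bar>L\<bar>"
        using y[of n] C X1 by (intro mult_mono) auto
      then have "\<bar>g n (x + t *\<^sub>R y n) \<bullet> y n\<bar> \<le> C * ((2 powr \<alpha> + 1) * X) * \<bar>L\<bar>"
        using Cauchy_Schwarz_ineq2 order_trans by blast
      then show ?thesis using t(2) by (simp add: mult_ac)
    qed
    then have "(\<Sum>n=1..T. G n x - C * (2 powr \<alpha> + 1) * \<bar>L\<bar> * X) \<le> (\<Sum>n=1..T. G n (x + y n))"
      by (intro sum_mono)
    then have "(\<Sum>n=1..T. G n x) - D * X \<le> (\<Sum>n=1..T. G n (x + y n))"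
      by (simp add: sum_subtractf D_def mult_ac)
    moreover have "X * (\<bar>Z\<bar> + D) \<le> (\<Sum>n=1..T. G n x)"
    proof -
      have eq: "X * (norm x powr (- \<alpha>) * (\<Sum>n=1..T. G n x)) = (\<Sum>n=1..T. G n x)"
        using X1 powr_minus[of "norm x" \<alpha>] by (simp flip: X_def)
      have "X * (\<bar>Z\<bar> + D) \<le> X * (norm x powr (- \<alpha>) * (\<Sum>n=1..T. G n x))"
        using x X1 by (intro mult_left_mono R) auto
      then show ?thesis unfolding eq .
    qed
    moreover have "\<bar>Z\<bar> \<le> X * \<bar>Z\<bar>" using X1 mult_right_mono[of 1 X "\<bar>Z\<bar>"] by simp
    ultimately show ?thesis by (simp add: algebra_simps)
  qed
  then show ?thesis by blast
qed

lemma homeomorphism_ball_blowup: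
  fixes \<phi> :: "'a::euclidean_space \<Rightarrow> 'b::euclidean_space"
  assumes "homeomorphism (ball 0 a) UNIV \<phi> \<psi>" "a > 0"
  shows "\<exists>\<rho><a. \<forall>z\<in>ball 0 a. norm (\<phi> z) \<le> B \<longrightarrow> norm z \<le> \<rho>"
proof (cases "B < 0")
  case True
  have "\<not> norm (\<phi> z) \<le> B" for z using norm_ge_zero[of "\<phi> z"] True by linarith
  then show ?thesis using assms(2) by blast
next
  case False
  have "continuous_on (cball 0 B) (\<lambda>p. norm (\<psi> p))"
    using assms(1) unfolding homeomorphism_def
    by (intro continuous_on_norm) (auto intro: continuous_on_subset)
  moreover have "cball (0::'b) B \<noteq> {}" using False by simp
  ultimately obtain p where p: "\<And>q. q \<in> cball 0 B \<Longrightarrow> norm (\<psi> q) \<le> norm (\<psi> p)"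
    using continuous_attains_sup[OF compact_cball] by blast
  have "\<psi> p \<in> ball 0 a" using assms(1) unfolding homeomorphism_def by blast
  moreover have "norm z \<le> norm (\<psi> p)" if "z \<in> ball 0 a" "norm (\<phi> z) \<le> B" for z
    using p[of "\<phi> z"] assms(1) that by (simp add: homeomorphism_def)
  ultimately show ?thesis by (intro exI[of _ "norm (\<psi> p)"]) auto
qed

section \<open>Existence of solutions\<close>

theorem theorem5p5:
  fixes T :: nat and a \<alpha> c :: real
    and \<phi> :: "real ^ 'n \<Rightarrow> real ^ 'n" and \<Phi> :: "real ^ 'n \<Rightarrow> real"
    and F :: "nat \<Rightarrow> real ^ 'n \<Rightarrow> real" and gF :: "nat \<Rightarrow> real ^ 'n \<Rightarrow> real ^ 'n"
    and j :: "(real ^ 'n) \<times> (real ^ 'n) \<Rightarrow> ereal"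
    and h :: "nat \<Rightarrow> real ^ 'n"
  assumes T: "T \<ge> 2" and a: "a > 0"
    and phi_homeo: "\<exists>\<psi>. homeomorphism (ball 0 a) UNIV \<phi> \<psi>"
    and phi_0: "\<phi> 0 = 0"
    and phi_grad: "\<And>x. x \<in> ball 0 a \<Longrightarrow> GDERIV \<Phi> x :> \<phi> x"
    and Phi_cont: "continuous_on (cball 0 a) \<Phi>"
    and Phi_convex: "strictly_convex_on (cball 0 a) \<Phi>"
    and Phi_0: "\<Phi> 0 = 0"
    and F_cont: "continuous_on ({1..T} \<times> UNIV) (\<lambda>(n, v). F n v)"
    and F_grad: "\<And>n v. n \<in> {1..T} \<Longrightarrow> GDERIV (F n) v :> gF n v"
    and gF_cont: "continuous_on ({1..T} \<times> UNIV) (\<lambda>(n, v). gF n v)"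
    and F_0: "\<And>n. n \<in> {1..T} \<Longrightarrow> F n 0 = 0"
    and j_proper: "proper_fun j"
    and j_convex: "convex_ereal j"
    and j_lsc: "lower_semicontinuous j"
    and j_0: "j (0, 0) = 0"
    and j_sub_0: "(0, 0) \<in> subdifferential j (0, 0)"
    and j_diag: "\<And>x. j (x, x) = 0"
    and j_bdd: "\<exists>M::real. \<forall>z\<in>eff_domain j. \<bar>j z\<bar> \<le> ereal M"
    and alpha: "\<alpha> \<ge> 0" and c: "c \<ge> 0"
    and growth: "\<And>n v. n \<in> {1..T} \<Longrightarrow> norm (gF n v) \<le> c * (norm v powr \<alpha> + 1)"
    and coercive: "filterlim
      (\<lambda>v. norm v powr (- \<alpha>) * (avg T (\<lambda>n. F n v) + avg T h \<bullet> v)) at_top at_infinity"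
  shows "\<exists>u. is_solution T a \<phi> gF h j u"
proof -
  have j_nonneg: "0 \<le> j z" for z
    using j_sub_0 j_0 by (cases z) (auto simp: subdifferential_def zero_prod_def[symmetric])
  have j_shift: "j (x, y) = j (0, y - x)" for x y
    by (rule diagonal_translation_invariance[OF j_convex j_lsc j_diag])
  obtain M :: real where M: "\<And>z. z \<in> eff_domain j \<Longrightarrow> \<bar>j z\<bar> \<le> ereal M" using j_bdd by blast
  have "(0, 0) \<in> eff_domain j" using j_0 by (simp add: eff_domain_def)
  then have M0: "0 \<le> M" using M j_0 by fastforce
  \<comment> \<open>Cutting the epigraph at height \<open>M\<close> loses no point of the domain of \<open>j\<close>.\<close>
  define S where "S = {(v, r::real). j (0, v) \<le> ereal r \<and> r \<le> M}"
  let ?epi = "{(z, r::real). j z \<le> ereal r}"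
  have S_eq: "S = (\<lambda>(v, r). ((0, v), r)) -` ?epi \<inter> snd -` {..M}"
    by (auto simp: S_def)
  have lin: "linear (\<lambda>(v :: real ^ 'n, r :: real). ((0 :: real ^ 'n, v), r))"
    by (rule linearI) auto
  have S_closed: "closed S"
    unfolding S_eq
    by (intro closed_Int closed_vimage closed_epigraph j_lsc closed_atMost)
       (auto simp: case_prod_beta intro!: continuous_intros)
  have S_convex: "convex S"
    unfolding S_eq
    by (intro convex_Int convex_linear_vimage convex_epigraph j_convex lin linear_snd) auto
  define G where "G n v = F n v + h n \<bullet> v" for n v
  define g where "g n v = gF n v + h n" for n v
  define H where "H = (\<Sum>n=1..T. norm (h n))"
  have G_grad: "GDERIV (G n) v :> g n v" if "n \<in> {1..T}" for n v
  proof -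
    have "GDERIV (\<lambda>v. h n \<bullet> v) v :> h n"
      by (auto simp: gderiv_def inner_commute intro!: derivative_eq_intros)
    then show ?thesis
      unfolding G_def g_def by (intro GDERIV_add F_grad that)
  qed
  have g_cont: "continuous_on UNIV (g n)" if "n \<in> {1..T}" for n
  proof -
    have "continuous_on UNIV (\<lambda>v. (\<lambda>(n, v). gF n v) (n, v))"
      by (rule continuous_on_compose2[OF gF_cont]) (use that in \<open>auto intro!: continuous_intros\<close>)
    then show ?thesis unfolding g_def by (intro continuous_intros) simp
  qed
  have g_growth: "norm (g n v) \<le> (c + H) * (norm v powr \<alpha> + 1)" if "n \<in> {1..T}" for n v
  proof -
    have H: "norm (h n) \<le> H" "0 \<le> H"
      unfolding H_def using that by (auto intro!: member_le_sum sum_nonneg)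
    have "norm (g n v) \<le> norm (gF n v) + norm (h n)" unfolding g_def by (rule norm_triangle_ineq)
    also have "\<dots> \<le> c * (norm v powr \<alpha> + 1) + H * (norm v powr \<alpha> + 1)"
      using growth[OF that, of v] H mult_left_mono[of 1 "norm v powr \<alpha> + 1" H] by simp
    finally show ?thesis by (simp add: distrib_right)
  qed
  have avg_eq: "real T * (norm v powr (- \<alpha>) * (avg T (\<lambda>n. F n v) + avg T h \<bullet> v)) =
      norm v powr (- \<alpha>) * (\<Sum>n=1..T. G n v)" for v
  proof -
    have "real T * (avg T (\<lambda>n. F n v) + avg T h \<bullet> v) = (\<Sum>n=1..T. G n v)"
      using T by (simp add: avg_def G_def sum.distrib inner_sum_left distrib_left)
    then show ?thesis by (metis mult.left_commute)
  qed
  have G_coercive: "filterlim (\<lambda>v. norm v powr (- \<alpha>) * (\<Sum>n=1..T. G n v)) at_top at_infinity"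
    using filterlim_tendsto_pos_mult_at_top[OF tendsto_const _ coercive, of "real T"] T
    unfolding avg_eq by simp
  interpret coercive_system T a M \<phi> \<Phi> S G g
  proof
    show "\<exists>\<rho><a. \<forall>z\<in>ball 0 a. norm (\<phi> z) \<le> B \<longrightarrow> norm z \<le> \<rho>" for B
      using phi_homeo homeomorphism_ball_blowup a by blast
    show "(0, 0) \<in> S" using j_0 M0 by (simp add: S_def)
    show "0 \<le> r \<and> r \<le> M" if "(v, r) \<in> S" for v r
      using that order_trans[OF j_nonneg[of "(0, v)"], of "ereal r"] by (simp add: S_def)
    have "0 \<le> c + H" using c by (simp add: H_def sum_nonneg)
    then show "\<exists>R. \<forall>x y. R \<le> norm x \<longrightarrow> (\<forall>n. norm (y n) \<le> real (T + 1) * a) \<longrightarrow>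
        Z \<le> (\<Sum>n=1..T. G n (x + y n))" for Z
      using perturbed_sum_coercive[OF G_grad g_growth _ alpha G_coercive] by blast
  qed (fact a phi_0 phi_grad Phi_cont Phi_convex S_closed S_convex G_grad g_cont)+
  obtain x k where k: "k \<in> admissible"
    and min: "\<And>l. l \<in> admissible \<Longrightarrow> tilted_energy (force (x, k)) k \<le> tilted_energy (force (x, k)) l"
    and zero: "(\<Sum>n=1..T. force (x, k) n) = 0"
    using critical_point_exists by blast
  define u where "u n = x + fst k n" for n
  define p where "p = \<phi> (fdiff (fst k) T)"
  have du: "fdiff u = fdiff (fst k)" by (simp add: fun_eq_iff fdiff_def u_def)
  have u0: "u 0 = x" using k by (simp add: u_def admissible_def)
  have eq: "\<phi> (fdiff u (n - 1)) - \<phi> (fdiff u n) = gF n (u n) + h n" if "n \<in> {1..T}" for n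
    using minimizer_difference_equation[OF k min that] by (simp add: du force_def g_def u_def)
  have "(\<Sum>n=1..N. \<phi> (fdiff (fst k) (n - 1)) - \<phi> (fdiff (fst k) n)) =
      \<phi> (fdiff (fst k) 0) - \<phi> (fdiff (fst k) N)" for N
    by (induction N) simp_all
  moreover have "(\<Sum>n=1..T. \<phi> (fdiff (fst k) (n - 1)) - \<phi> (fdiff (fst k) n)) = 0"
    using minimizer_difference_equation[OF k min] zero by simp
  \<comment> \<open>The difference equations telescope to the vanishing total force.\<close>
  ultimately have p0: "\<phi> (fdiff (fst k) 0) = p" unfolding p_def by (metis eq_iff_diff_eq_0)
  have sub: "(p, - p) \<in> subdifferential j (u 0, u (T + 1))"
    unfolding subdifferential_def
  proof (intro CollectI allI)
    fix z :: "(real ^ 'n) \<times> (real ^ 'n)"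
    obtain y y' where z: "z = (y, y')" by (cases z)
    show "j (u 0, u (T + 1)) + ereal ((p, - p) \<bullet> (z - (u 0, u (T + 1)))) \<le> j z"
    proof (cases "j z = \<infinity>")
      case False
      then have dom: "z \<in> eff_domain j" by (simp add: eff_domain_def less_top)
      then obtain r where r: "j z = ereal r" "r \<le> M"
        using M[OF dom] False j_nonneg[of z] by (cases "j z") auto
      then have "(y' - y, r) \<in> S" using j_shift[of y y'] by (simp add: S_def z)
      from minimizer_boundary_inequality[OF k min this]
      have "snd k - p \<bullet> (y' - y - fst k (T + 1)) \<le> r" by (simp add: p_def)
      moreover have "(p, - p) \<bullet> (z - (u 0, u (T + 1))) = - (p \<bullet> (y' - y - fst k (T + 1)))"
        unfolding z u0 by (simp add: u_def inner_diff_right inner_add_right)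
      ultimately have "ereal (snd k) + ereal ((p, - p) \<bullet> (z - (u 0, u (T + 1)))) \<le> ereal r"
        by simp
      moreover have "(fst k (T + 1), snd k) \<in> S" using k by (simp add: admissible_def)
      then have "j (u 0, u (T + 1)) \<le> ereal (snd k)"
        using j_shift[of "u 0" "u (T + 1)"] unfolding u0 by (simp add: u_def S_def)
      ultimately show ?thesis
        unfolding r(1) using add_right_mono order_trans by blast
    qed simp
  qed
  have "fdiff_norm T u < a"
    using minimizer_interior[OF k min] by (auto simp: fdiff_norm_def du)
  then have "is_solution T a \<phi> gF h j u"
    using sub eq p0 by (auto simp: is_solution_def du p_def) (auto simp: fdiff_def)
  then show ?thesis by blast
qed

end
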